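(* Let $M_s^m$, $s\in(0,\pi/4)$, be a family of isoparametric hypersurfaces of degree $4$ in $\mathbb{S}^{m+1}$ with multiplicities $m_1<m_2$, $m=2(m_1+m_2)$. Then there exists a unique $s^*\in(0,\pi/4)$ such that $M_{s^*}^m$ is an isoparametric $c$-biharmonic hypersurface in $\mathbb{S}^{m+1}$. Moreover, the $c$-biharmonic hypersurface $M_{s^*}^m$ is non-minimal.
   Context: A hypersurface of the unit sphere $\mathbb{S}^{m+1}$ is isoparametric if it has constant principal curvatures; its degree $\ell$ is the number of distinct principal curvatures $k_1>\cdots>k_\ell$. Their multiplicities satisfy $m_{i+2}=m_i$ (indices mod $\ell$), so there are at most two distinct multiplicities $m_1,m_2$. Isoparametric hypersurfaces of degree $\ell$ come in families $M_s^m$, $s\in(0,\pi/\ell)$, of parallel hypersurfaces, and (with suitable orientation, so that $m_1\le m_2$) the principal curvatures of $M_s^m$ are $$k_i(s)=\cot\left(s+\frac{(i-1)\pi}{\ell}\right),\quad i=1,\dots,\ell,$$ where $k_i(s)$ has multiplicity $m_i$; for $\ell=4$, $k_1,k_3$ have multiplicity $m_1$ and $k_2,k_4$ have multiplicity $m_2$. Minimal means $\mathrm{Tr}A=0$, with $A$ the shape operator. Conventions: $R(X,Y)Z=[\nabla_X,\nabla_Y]Z-\nabla_{[X,Y]}Z$; $g(\mathrm{Ric}(X),Y)=\mathrm{Ric}(X,Y)=\mathrm{Tr}\{Z\mapsto R(Z,X)Y\}$; $\mathrm{Scal}=\mathrm{Tr}\,\mathrm{Ric}$; traces are taken with respect to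 the domain metric. $c$-biharmonic maps: for a smooth map $\phi:(M^m,g)\to(N^n,h)$ of Riemannian manifolds, let $\bar\nabla$ be the connection on $\phi^{-1}TN$, $\tau(\phi)=\mathrm{Tr}\,\bar\nabla d\phi$ the tension field, $\bar\Delta=-\mathrm{Tr}(\bar\nabla\bar\nabla-\bar\nabla_{\nabla})$ the rough Laplacian on $\phi^{-1}TN$, and $\tau_2(\phi)=-\bar\Delta\tau(\phi)-\mathrm{Tr}\,R^N(d\phi(\cdot),\tau(\phi))d\phi(\cdot)$ the bitension field. The map $\phi$ is $c$-biharmonic (conformal-biharmonic) if $$\tau_2^c(\phi):=\tau_2(\phi)-\tfrac23\,\mathrm{Scal}\,\tau(\phi)+2\,\mathrm{Tr}(\bar\nabla d\phi)(\mathrm{Ric}(\cdot),\cdot)+\tfrac13 d\phi(\nabla\mathrm{Scal})=0,$$ where $\mathrm{Scal}$ and $\mathrm{Ric}$ are those of $(M,g)$. A $c$-biharmonic hypersurface is a codimension-one isometric immersion that is a $c$-biharmonic map. All hypersurfaces are oriented and without boundary. *)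

theory Defs
  imports "HOL-Analysis.Analysis"
begin

section \<open>Smooth maps and manifolds\<close>

definition pderiv_dir :: "'m \<Rightarrow> (real^'m \<Rightarrow> 'e) \<Rightarrow> real^'m \<Rightarrow> 'e::real_normed_vector" where
  "pderiv_dir i f u = frechet_derivative f (at u) (axis i 1)"

definition iter_pderiv :: "'m list \<Rightarrow> (real^'m \<Rightarrow> 'e) \<Rightarrow> real^'m \<Rightarrow> 'e::real_normed_vector" where
  "iter_pderiv is f = foldr pderiv_dir is f"

text \<open>Being of class \<open>C\<^sup>\<infinity>\<close> on an open set: all iterated partial derivatives exist and are
  (Frechet) differentiable.\<close>

definition smooth_on :: "(real^'m) set \<Rightarrow> (real^'m \<Rightarrow> 'e::real_normed_vector) \<Rightarrow> bool" where
  "smooth_on U f \<longleftrightarrow> (\<forall>is. \<forall>u\<in>U. iter_pderiv is f differentiable (at u))"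

text \<open>A chart is given by a local parametrization: a pair \<open>(U, x)\<close> with \<open>x\<close> a homeomorphism from
  the open set \<open>U\<close> of Euclidean space onto an open set of the manifold. The values of \<open>x\<close>
  outside \<open>U\<close> are irrelevant. The manifold is the whole Hausdorff, second countable type \<open>'a\<close>;
  its dimension is \<open>CARD('m)\<close>.\<close>

type_synonym ('a, 'm) chart = "(real^'m) set \<times> (real^'m \<Rightarrow> 'a)"

definition smooth_atlas ::
    "('a::{t2_space, second_countable_topology}, 'm::finite) chart set \<Rightarrow> bool" where
  "smooth_atlas \<A> \<longleftrightarrow>
     (\<forall>(U, x)\<in>\<A>. open U \<and> open (x ` U) \<and> (\<exists>y. homeomorphism U (x ` U) x y)) \<and>
     (\<Union>(U, x)\<in>\<A>. x ` U) = UNIV \<and>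
     (\<forall>(U, x)\<in>\<A>. \<forall>(V, y)\<in>\<A>. smooth_on {u\<in>U. x u \<in> y ` V} (the_inv_into V y \<circ> x))"

definition smooth_map ::
    "('a, 'm::finite) chart set \<Rightarrow> ('a \<Rightarrow> 'e::real_normed_vector) \<Rightarrow> bool" where
  "smooth_map \<A> f \<longleftrightarrow> (\<forall>(U, x)\<in>\<A>. smooth_on U (f \<circ> x))"

section \<open>Connections and curvature\<close>

text \<open>Vector fields on (open subsets of) a normed space are functions \<open>'v \<Rightarrow> 'v\<close>.\<close>

definition lie_bracket :: "('v \<Rightarrow> 'v) \<Rightarrow> ('v \<Rightarrow> 'v) \<Rightarrow> 'v \<Rightarrow> 'v::real_normed_vector" where
  "lie_bracket X Y p = frechet_derivative Y (at p) (X p) - frechet_derivative X (at p) (Y p)"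

definition curvature :: "(('v \<Rightarrow> 'v) \<Rightarrow> ('v \<Rightarrow> 'v) \<Rightarrow> 'v \<Rightarrow> 'v) \<Rightarrow>
    ('v \<Rightarrow> 'v) \<Rightarrow> ('v \<Rightarrow> 'v) \<Rightarrow> ('v \<Rightarrow> 'v) \<Rightarrow> 'v \<Rightarrow> 'v::real_normed_vector" where
  "curvature conn X Y Z p =
     conn X (conn Y Z) p - conn Y (conn X Z) p - conn (lie_bracket X Y) Z p"

subsection \<open>A Riemannian metric in coordinates\<close>

text \<open>In a chart a metric is a function \<open>g\<close> assigning to each point the matrix \<open>g\<^sub>i\<^sub>j\<close>.
  Below, \<open>christoffel g u k i j\<close> is \<open>\<Gamma>\<^sup>k\<^sub>i\<^sub>j\<close>, and \<open>levi_civita g X Y\<close> is \<open>\<nabla>\<^sub>X Y\<close>.\<close>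

type_synonym 'm metric = "real^'m \<Rightarrow> real^'m^'m"

definition christoffel :: "'m::finite metric \<Rightarrow> real^'m \<Rightarrow> 'm \<Rightarrow> 'm \<Rightarrow> 'm \<Rightarrow> real" where
  "christoffel g u k i j = 1 / 2 * (\<Sum>l\<in>UNIV. matrix_inv (g u) $ k $ l *
     (pderiv_dir i (\<lambda>w. g w $ j $ l) u + pderiv_dir j (\<lambda>w. g w $ i $ l) u
        - pderiv_dir l (\<lambda>w. g w $ i $ j) u))"

definition levi_civita :: "'m::finite metric \<Rightarrow>
    (real^'m \<Rightarrow> real^'m) \<Rightarrow> (real^'m \<Rightarrow> real^'m) \<Rightarrow> real^'m \<Rightarrow> real^'m" where
  "levi_civita g X Y u = frechet_derivative Y (at u) (X u) +
     (\<chi> k. \<Sum>i\<in>UNIV. \<Sum>j\<in>UNIV. christoffel g u k i j * X u $ i * Y u $ j)"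

text \<open>\<open>Ric(v, w) = Tr {z \<mapsto> R(z, v) w}\<close>; tangent vectors are extended as
  fields with constant coordinates, which is immaterial since \<open>R\<close> is tensorial.\<close>

definition ricci :: "'m::finite metric \<Rightarrow> real^'m \<Rightarrow> real^'m \<Rightarrow> real^'m \<Rightarrow> real" where
  "ricci g u v w =
     trace (matrix (\<lambda>z. curvature (levi_civita g) (\<lambda>_. z) (\<lambda>_. v) (\<lambda>_. w) u))"

text \<open>The vector representing a linear form with respect to the metric.\<close>

definition sharp :: "'m::finite metric \<Rightarrow> real^'m \<Rightarrow> (real^'m \<Rightarrow> real) \<Rightarrow> real^'m" where
  "sharp g u \<alpha> = matrix_inv (g u) *v (\<chi> j. \<alpha> (axis j 1))"

definition ricci_op :: "'m::finite metric \<Rightarrow> real^'m \<Rightarrow> real^'m \<Rightarrow> real^'m" where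
  "ricci_op g u v = sharp g u (ricci g u v)"

definition scal :: "'m::finite metric \<Rightarrow> real^'m \<Rightarrow> real" where
  "scal g u = trace (matrix (ricci_op g u))"

definition grad :: "'m::finite metric \<Rightarrow> (real^'m \<Rightarrow> real) \<Rightarrow> real^'m \<Rightarrow> real^'m" where
  "grad g h u = sharp g u (frechet_derivative h (at u))"

definition metric_trace :: "'m::finite metric \<Rightarrow> real^'m \<Rightarrow>
    (real^'m \<Rightarrow> real^'m \<Rightarrow> 'e) \<Rightarrow> 'e::real_vector" where
  "metric_trace g u b =
     (\<Sum>i\<in>UNIV. \<Sum>j\<in>UNIV. matrix_inv (g u) $ i $ j *\<^sub>R b (axis i 1) (axis j 1))"

subsection \<open>The unit sphere of a Euclidean space\<close>

text \<open>\<open>sphere_proj p\<close> is the orthogonal projection onto the tangent space at a point \<open>p\<close> of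
  the unit sphere; the Levi-Civita connection of the sphere is the tangential part of the
  ambient derivative. Fields on the sphere are restrictions of fields on the ambient space. The
  connection only differentiates along the sphere when \<open>X\<close> is tangent, so that at points of the
  sphere nothing depends on how fields are extended off it.\<close>

definition sphere_proj :: "'e \<Rightarrow> 'e \<Rightarrow> 'e::euclidean_space" where
  "sphere_proj p v = v - (v \<bullet> p) *\<^sub>R p"

definition sphere_conn :: "('e \<Rightarrow> 'e) \<Rightarrow> ('e \<Rightarrow> 'e) \<Rightarrow> 'e \<Rightarrow> 'e::euclidean_space" where
  "sphere_conn X Y p = sphere_proj p (frechet_derivative Y (at p) (X p))"

text \<open>\<open>R(v, w) z\<close> for vectors tangent at \<open>p\<close>, extended as the tangent fields
  \<open>q \<mapsto> sphere_proj q v\<close>; by tensoriality the choice of the extension is immaterial.\<close>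

definition sphere_curvature :: "'e \<Rightarrow> 'e \<Rightarrow> 'e \<Rightarrow> 'e \<Rightarrow> 'e::euclidean_space" where
  "sphere_curvature p v w z = curvature sphere_conn
     (\<lambda>q. sphere_proj q v) (\<lambda>q. sphere_proj q w) (\<lambda>q. sphere_proj q z) p"

section \<open>Conformal-biharmonic maps into the sphere\<close>

text \<open>Here \<open>f\<close> is the coordinate expression of a map into the unit sphere, and sections \<open>V\<close> of the
  pull-back of the tangent bundle are functions of the coordinates with values in the
  ambient space. \<open>pullback_conn\<close> is the connection \<open>\<nabla>-bar\<close> on the pull-back bundle, and
  \<open>second_form\<close> is \<open>\<nabla>-bar df\<close>, i.e. \<open>(v, w) \<mapsto> \<nabla>-bar\<^sub>v (df w) - df (\<nabla>\<^sub>v w)\<close>.\<close>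

definition pullback_conn :: "(real^'m \<Rightarrow> 'e) \<Rightarrow> (real^'m \<Rightarrow> real^'m) \<Rightarrow>
    (real^'m \<Rightarrow> 'e) \<Rightarrow> real^'m::finite \<Rightarrow> 'e::euclidean_space" where
  "pullback_conn f X V u = sphere_proj (f u) (frechet_derivative V (at u) (X u))"

definition second_form :: "'m::finite metric \<Rightarrow> (real^'m \<Rightarrow> 'e) \<Rightarrow>
    real^'m \<Rightarrow> real^'m \<Rightarrow> real^'m \<Rightarrow> 'e::euclidean_space" where
  "second_form g f u v w =
     pullback_conn f (\<lambda>_. v) (\<lambda>y. frechet_derivative f (at y) w) u
     - frechet_derivative f (at u) (levi_civita g (\<lambda>_. v) (\<lambda>_. w) u)"

definition tension :: "'m::finite metric \<Rightarrow> (real^'m \<Rightarrow> 'e) \<Rightarrow> real^'m \<Rightarrow> 'e::euclidean_space" where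
  "tension g f u = metric_trace g u (second_form g f u)"

definition rough_laplacian :: "'m::finite metric \<Rightarrow> (real^'m \<Rightarrow> 'e) \<Rightarrow>
    (real^'m \<Rightarrow> 'e) \<Rightarrow> real^'m \<Rightarrow> 'e::euclidean_space" where
  "rough_laplacian g f V u = - metric_trace g u (\<lambda>v w.
     pullback_conn f (\<lambda>_. v) (pullback_conn f (\<lambda>_. w) V) u
     - pullback_conn f (levi_civita g (\<lambda>_. v) (\<lambda>_. w)) V u)"

definition bitension :: "'m::finite metric \<Rightarrow> (real^'m \<Rightarrow> 'e) \<Rightarrow> real^'m \<Rightarrow> 'e::euclidean_space" where
  "bitension g f u =
     - rough_laplacian g f (tension g f) u
     - metric_trace g u (\<lambda>v w. sphere_curvature (f u)
         (frechet_derivative f (at u) v) (tension g f u) (frechet_derivative f (at u) w))"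

definition c_bitension :: "'m::finite metric \<Rightarrow> (real^'m \<Rightarrow> 'e) \<Rightarrow> real^'m \<Rightarrow> 'e::euclidean_space" where
  "c_bitension g f u =
     bitension g f u
     - (2 / 3 * scal g u) *\<^sub>R tension g f u
     + 2 *\<^sub>R metric_trace g u (\<lambda>v w. second_form g f u (ricci_op g u v) w)
     + (1 / 3) *\<^sub>R frechet_derivative f (at u) (grad g (scal g) u)"

text \<open>A Riemannian metric \<open>g\<close> on the manifold is given by its coordinate expressions: \<open>g x\<close> is
  the matrix function of the metric in the local parametrization \<open>x\<close>.\<close>

definition c_biharmonic :: "('a, 'm::finite) chart set \<Rightarrow> ((real^'m \<Rightarrow> 'a) \<Rightarrow> 'm metric) \<Rightarrow>
    ('a \<Rightarrow> 'e::euclidean_space) \<Rightarrow> bool" where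
  "c_biharmonic \<A> g \<phi> \<longleftrightarrow> smooth_map \<A> \<phi> \<and> range \<phi> \<subseteq> sphere 0 1 \<and>
     (\<forall>(U, x)\<in>\<A>. \<forall>u\<in>U. c_bitension (g x) (\<phi> \<circ> x) u = 0)"

section \<open>Oriented hypersurfaces of the sphere\<close>

text \<open>The immersion \<open>\<phi>\<close> is codimension one in the unit sphere of \<open>'e\<close>, and the orientation is
  given by the global unit normal field \<open>N\<close>, tangent to the sphere.\<close>

definition oriented_hypersurface :: "('a, 'm::finite) chart set \<Rightarrow>
    ('a \<Rightarrow> 'e) \<Rightarrow> ('a \<Rightarrow> 'e::euclidean_space) \<Rightarrow> bool" where
  "oriented_hypersurface \<A> \<phi> N \<longleftrightarrow>
     DIM('e) = CARD('m) + 2 \<and>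
     smooth_map \<A> \<phi> \<and> smooth_map \<A> N \<and>
     (\<forall>p. norm (\<phi> p) = 1 \<and> norm (N p) = 1 \<and> N p \<bullet> \<phi> p = 0) \<and>
     (\<forall>(U, x)\<in>\<A>. \<forall>u\<in>U. inj (frechet_derivative (\<phi> \<circ> x) (at u)) \<and>
        (\<forall>v. N (x u) \<bullet> frechet_derivative (\<phi> \<circ> x) (at u) v = 0))"

definition induced_metric ::
    "('a \<Rightarrow> 'e::euclidean_space) \<Rightarrow> (real^'m \<Rightarrow> 'a) \<Rightarrow> 'm::finite metric" where
  "induced_metric \<phi> x u =
     (\<chi> i j. pderiv_dir i (\<phi> \<circ> x) u \<bullet> pderiv_dir j (\<phi> \<circ> x) u)"

definition c_biharmonic_hypersurface :: "('a, 'm::finite) chart set \<Rightarrow>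
    ('a \<Rightarrow> 'e) \<Rightarrow> ('a \<Rightarrow> 'e::euclidean_space) \<Rightarrow> bool" where
  "c_biharmonic_hypersurface \<A> \<phi> N \<longleftrightarrow>
     oriented_hypersurface \<A> \<phi> N \<and> c_biharmonic \<A> (induced_metric \<phi>) \<phi>"

text \<open>The shape operator \<open>A\<close> in coordinates, \<open>df (A v) = - \<nabla>-bar\<^sub>v n\<close>, where \<open>f\<close> and \<open>n\<close> are the
  coordinate expressions of the immersion and of the unit normal.\<close>

definition shape_op :: "(real^'m \<Rightarrow> 'e) \<Rightarrow> (real^'m \<Rightarrow> 'e::euclidean_space) \<Rightarrow>
    real^'m::finite \<Rightarrow> real^'m \<Rightarrow> real^'m" where
  "shape_op f n u v =
     (THE w. frechet_derivative f (at u) w = - pullback_conn f (\<lambda>_. v) n u)"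
definition minimal_hypersurface :: "('a, 'm::finite) chart set \<Rightarrow>
    ('a \<Rightarrow> 'e) \<Rightarrow> ('a \<Rightarrow> 'e::euclidean_space) \<Rightarrow> bool" where
  "minimal_hypersurface \<A> \<phi> N \<longleftrightarrow> oriented_hypersurface \<A> \<phi> N \<and>
     (\<forall>(U, x)\<in>\<A>. \<forall>u\<in>U. trace (matrix (shape_op (\<phi> \<circ> x) (N \<circ> x) u)) = 0)"

definition principal_curvatures ::
    "(real^'m \<Rightarrow> 'e) \<Rightarrow> (real^'m \<Rightarrow> 'e::euclidean_space) \<Rightarrow> real^'m::finite \<Rightarrow> real set" where
  "principal_curvatures f n u = {k. \<exists>v. v \<noteq> 0 \<and> shape_op f n u v = k *\<^sub>R v}"

definition curvature_mult ::
    "(real^'m \<Rightarrow> 'e) \<Rightarrow> (real^'m \<Rightarrow> 'e::euclidean_space) \<Rightarrow> real^'m::finite \<Rightarrow> real \<Rightarrow> nat" where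
  "curvature_mult f n u k = dim {v. shape_op f n u v = k *\<^sub>R v}"

definition isoparametric :: "nat \<Rightarrow> ('a, 'm::finite) chart set \<Rightarrow>
    ('a \<Rightarrow> 'e) \<Rightarrow> ('a \<Rightarrow> 'e::euclidean_space) \<Rightarrow> bool" where
  "isoparametric l \<A> \<phi> N \<longleftrightarrow> oriented_hypersurface \<A> \<phi> N \<and>
     (\<exists>K \<mu>. card K = l \<and> (\<forall>(U, x)\<in>\<A>. \<forall>u\<in>U.
        principal_curvatures (\<phi> \<circ> x) (N \<circ> x) u = K \<and>
        (\<forall>k\<in>K. curvature_mult (\<phi> \<circ> x) (N \<circ> x) u k = \<mu> k)))"

text \<open>A family of parallel isoparametric hypersurfaces of degree \<open>l\<close>, parametrized (and oriented)
  so that the principal curvatures of the member \<open>s\<close> are \<open>cot (s + (i - 1) \<pi> / l)\<close>, with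
  multiplicity \<open>\<mu> i\<close>, for \<open>i = 1, \<dots>, l\<close>. All members are immersions of the same manifold. With
  the sign of the shape operator fixed above, increasing \<open>s\<close> means moving along the normal
  geodesics in the direction of \<open>- N\<close>.\<close>

definition isoparametric_family :: "nat \<Rightarrow> (nat \<Rightarrow> nat) \<Rightarrow> ('a, 'm::finite) chart set \<Rightarrow>
    (real \<Rightarrow> 'a \<Rightarrow> 'e) \<Rightarrow> (real \<Rightarrow> 'a \<Rightarrow> 'e::euclidean_space) \<Rightarrow> bool" where
  "isoparametric_family l \<mu> \<A> \<phi> N \<longleftrightarrow>
     (\<forall>s\<in>{0<..<pi / real l}. isoparametric l \<A> (\<phi> s) (N s)) \<and>
     (\<forall>s\<in>{0<..<pi / real l}. \<forall>t\<in>{0<..<pi / real l}. \<forall>p.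
        \<phi> s p = cos (s - t) *\<^sub>R \<phi> t p - sin (s - t) *\<^sub>R N t p \<and>
        N s p = sin (s - t) *\<^sub>R \<phi> t p + cos (s - t) *\<^sub>R N t p) \<and>
     (\<forall>s\<in>{0<..<pi / real l}. \<forall>(U, x)\<in>\<A>. \<forall>u\<in>U.
        principal_curvatures (\<phi> s \<circ> x) (N s \<circ> x) u
          = (\<lambda>i. cot (s + real (i - 1) * pi / real l)) ` {1..l} \<and>
        (\<forall>i\<in>{1..l}. curvature_mult (\<phi> s \<circ> x) (N s \<circ> x) u
          (cot (s + real (i - 1) * pi / real l)) = \<mu> i))"

end

theory Submission
  imports Defs
begin

text \<open>
  Differentiating the Gauss formula gives the Gauss equation, hence
  \<open>Ric = (m - 1) I + (Tr A) A - A\<^sup>2\<close>. When \<open>Tr A\<close> and \<open>Tr A\<^sup>2\<close> are constant, the Codazzi equation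
  makes the tangential part of the rough Laplacian of \<open>(Tr A) N\<close> equal to the gradient of \<open>Tr A\<close>
  up to a factor, hence zero, and \<open>\<tau>\<^sub>2\<^sup>c\<close> becomes a multiple of \<open>N\<close> by a polynomial in
  \<open>m, Tr A, Tr A\<^sup>2, Tr A\<^sup>3\<close>. In degree 4, with \<open>a = cot s - tan s = 2 cot 2s\<close>, one has
  \<open>k\<^sub>1 + k\<^sub>3 = a\<close>, \<open>k\<^sub>2 + k\<^sub>4 = - 4 / a\<close> and \<open>k\<^sub>1 k\<^sub>3 = k\<^sub>2 k\<^sub>4 = - 1\<close>, so that the equation is a cubic
  in \<open>a\<^sup>2\<close>, negative at infinity and positive at 0; it has exactly one positive root. In the minimal
  case \<open>m\<^sub>1 a\<^sup>2 = 4 m\<^sub>2\<close> it would reduce to \<open>Tr A\<^sup>3 = 0\<close>, which forces \<open>m\<^sub>1 = m\<^sub>2\<close>.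
\<close>

section \<open>Directional derivatives\<close>

text \<open>The obstacle is that \<open>shape_op\<close> is a description and
  \<open>christoffel\<close> contains a matrix inverse, and neither form says anything about
  derivatives. The ambient space removes it. At each point \<open>f u\<close>, \<open>n u\<close>
  and the image of the differential span everything, so a vector identity is proved by testing both
  sides against this frame, and the tests are inner products that can be differentiated. The vectors
  \<open>A u v\<close> and \<open>\<Gamma> u v w\<close> then solve linear systems with matrix
  \<open>g u\<close>, which makes them differentiable. \<open>dd\<close> takes the direction first
  so that \<open>dd v (dd w F)\<close> is an iterated derivative; the symmetry of such derivatives
  is the common source of self-adjointness, of the Gauss equation and of the Codazzi equation.
  Uniqueness of the root is more than a count of sign changes: for three small pairs of
  multiplicities the signs would allow three positive roots, and there the cubic is shown to be
  monotone.\<close>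

definition dd :: "'v \<Rightarrow> ('v \<Rightarrow> 'e) \<Rightarrow> 'v::real_normed_vector \<Rightarrow> 'e::real_normed_vector" where
  "dd v F u = frechet_derivative F (at u) v"

lemma pderiv_dir_eq_dd: "pderiv_dir i F = dd (axis i 1) F"
  by (rule ext) (simp add: pderiv_dir_def dd_def)

lemma dd_eqI: "(F has_derivative F') (at u) \<Longrightarrow> dd v F u = F' v"
  unfolding dd_def using frechet_derivative_at by metis

lemma has_derivative_dd: "F differentiable (at u) \<Longrightarrow> (F has_derivative (\<lambda>v. dd v F u)) (at u)"
  unfolding dd_def using frechet_derivative_works by auto

text \<open>Coordinate expressions are controlled only on the open domain of a chart. This is what
  allows an identity valid there to be differentiated.\<close>

lemma has_derivative_cong_open:
  assumes "open U" "u \<in> U" "\<And>y. y \<in> U \<Longrightarrow> F y = G y"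
  shows "(F has_derivative F') (at u) \<longleftrightarrow> (G has_derivative F') (at u)"
  using has_derivative_transform_within_open[of F F' u UNIV U G]
    has_derivative_transform_within_open[of G F' u UNIV U F] assms by auto

text \<open>\<open>frechet_derivative\<close> is a choice from the set of all derivatives, and both
  functions have the same set, empty or not.\<close>

lemma dd_cong_open:
  assumes "open U" "u \<in> U" "\<And>y. y \<in> U \<Longrightarrow> F y = G y"
  shows "dd v F u = dd v G u"
  unfolding dd_def frechet_derivative_def using has_derivative_cong_open[OF assms] by simp

lemma differentiable_cong_open:
  assumes "open U" "u \<in> U" "\<And>y. y \<in> U \<Longrightarrow> F y = G y"
  shows "F differentiable (at u) \<longleftrightarrow> G differentiable (at u)"
  unfolding differentiable_def using has_derivative_cong_open[OF assms] by simp

lemma linear_dd: "F differentiable (at u) \<Longrightarrow> linear (\<lambda>v. dd v F u)"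
  unfolding dd_def using linear_frechet_derivative by blast

lemma dd_add_dir: "F differentiable (at u) \<Longrightarrow> dd (v + w) F u = dd v F u + dd w F u"
  by (rule linear_add[OF linear_dd])

lemma dd_scaleR_dir: "F differentiable (at u) \<Longrightarrow> dd (c *\<^sub>R v) F u = c *\<^sub>R dd v F u"
  by (rule linear_scale[OF linear_dd])

lemma dd_const: "dd v (\<lambda>_. c) u = 0"
  by (rule dd_eqI) (rule has_derivative_const)

lemma dd_add:
  assumes "F differentiable (at u)" "G differentiable (at u)"
  shows "dd v (\<lambda>y. F y + G y) u = dd v F u + dd v G u"
  by (rule dd_eqI) (intro has_derivative_add has_derivative_dd assms)

lemma dd_diff:
  assumes "F differentiable (at u)" "G differentiable (at u)"
  shows "dd v (\<lambda>y. F y - G y) u = dd v F u - dd v G u"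
  by (rule dd_eqI) (intro has_derivative_diff has_derivative_dd assms)

lemma dd_minus:
  assumes "F differentiable (at u)"
  shows "dd v (\<lambda>y. - F y) u = - dd v F u"
  by (rule dd_eqI) (intro has_derivative_minus has_derivative_dd assms)

lemma dd_sum:
  assumes "\<And>i. i \<in> I \<Longrightarrow> F i differentiable (at u)"
  shows "dd v (\<lambda>y. \<Sum>i\<in>I. F i y) u = (\<Sum>i\<in>I. dd v (F i) u)"
  by (rule dd_eqI) (intro has_derivative_sum has_derivative_dd assms)

lemma dd_scaleR_const:
  assumes "F differentiable (at u)"
  shows "dd v (\<lambda>y. c *\<^sub>R F y) u = c *\<^sub>R dd v F u"
  by (rule dd_eqI) (intro has_derivative_scaleR_right has_derivative_dd assms)

lemma dd_scaleR:
  assumes "c differentiable (at u)" "F differentiable (at u)"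
  shows "dd v (\<lambda>y. c y *\<^sub>R F y) u = dd v c u *\<^sub>R F u + c u *\<^sub>R dd v F u"
  by (subst dd_eqI[OF has_derivative_scaleR[OF has_derivative_dd has_derivative_dd]])
    (use assms in auto)

lemma dd_inner:
  fixes F G :: "'v::real_normed_vector \<Rightarrow> 'e::real_inner"
  assumes "F differentiable (at u)" "G differentiable (at u)"
  shows "dd v (\<lambda>y. F y \<bullet> G y) u = F u \<bullet> dd v G u + dd v F u \<bullet> G u"
  by (subst dd_eqI[OF has_derivative_inner[OF has_derivative_dd has_derivative_dd]])
    (use assms in auto)

lemma dd_apply_bounded_linear:
  assumes "bounded_linear L" "F differentiable (at u)"
  shows "dd v (\<lambda>y. L (F y)) u = L (dd v F u)"
  by (rule dd_eqI) (rule bounded_linear.has_derivative[OF assms(1) has_derivative_dd[OF assms(2)]])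

lemma vec_expansion: "(v::real^'m) = (\<Sum>i\<in>UNIV. v $ i *\<^sub>R axis i 1)"
  using basis_expansion[of v] by (simp add: scalar_mult_eq_scaleR)

lemma linear_eq_sum_axis:
  fixes L :: "real^'m \<Rightarrow> 'e::real_vector"
  assumes "linear L"
  shows "L v = (\<Sum>i\<in>UNIV. v $ i *\<^sub>R L (axis i 1))"
proof -
  have "L v = L (\<Sum>i\<in>UNIV. v $ i *\<^sub>R axis i 1)"
    using vec_expansion[of v] by simp
  then show ?thesis by (simp add: linear_sum[OF assms] linear_scale[OF assms])
qed

lemma dd_eq_sum_pderiv_dir:
  "F differentiable (at u) \<Longrightarrow> dd v F u = (\<Sum>i\<in>UNIV. v $ i *\<^sub>R pderiv_dir i F u)"
  unfolding pderiv_dir_eq_dd by (rule linear_eq_sum_axis[OF linear_dd])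

section \<open>Smooth functions and the symmetry of second derivatives\<close>

lemma smooth_on_imp_differentiable: "smooth_on U F \<Longrightarrow> u \<in> U \<Longrightarrow> F differentiable (at u)"
  unfolding smooth_on_def by (drule spec[of _ "[]"]) (simp add: iter_pderiv_def)

lemma iter_pderiv_Cons: "iter_pderiv (i # is) F = pderiv_dir i (iter_pderiv is F)"
  by (simp add: iter_pderiv_def)

lemma smooth_on_pderiv_dir: "smooth_on U F \<Longrightarrow> smooth_on U (pderiv_dir i F)"
  unfolding smooth_on_def
proof (intro allI ballI)
  fix "is" u assume F: "\<forall>is. \<forall>u\<in>U. iter_pderiv is F differentiable at u" and u: "u \<in> U"
  have "iter_pderiv is (pderiv_dir i F) = iter_pderiv (is @ [i]) F"
    by (simp add: iter_pderiv_def)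
  then show "iter_pderiv is (pderiv_dir i F) differentiable at u" using F u by metis
qed

lemma iter_pderiv_cong:
  assumes "open U" "\<And>y. y \<in> U \<Longrightarrow> F y = G y" "u \<in> U"
  shows "iter_pderiv is F u = iter_pderiv is G u"
  using assms(3)
proof (induction "is" arbitrary: u)
  case Nil
  then show ?case using assms by (simp add: iter_pderiv_def)
next
  case (Cons i "is")
  then show ?case
    unfolding iter_pderiv_Cons pderiv_dir_eq_dd by (intro dd_cong_open[OF assms(1)]) auto
qed

lemma smooth_on_cong:
  assumes "open U" "\<And>y. y \<in> U \<Longrightarrow> F y = G y" "smooth_on U G"
  shows "smooth_on U F"
  unfolding smooth_on_def
proof (intro allI ballI)
  fix "is" u assume u: "u \<in> U"
  show "iter_pderiv is F differentiable at u"
    using differentiable_cong_open[of U u "iter_pderiv is F" "iter_pderiv is G"]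
      iter_pderiv_cong[of U F G] assms u unfolding smooth_on_def by blast
qed

lemma iter_pderiv_sum_scaleR:
  assumes U: "open U" and F: "\<And>i. i \<in> I \<Longrightarrow> smooth_on U (F i)" and u: "u \<in> U"
  shows "iter_pderiv is (\<lambda>y. \<Sum>i\<in>I. c i *\<^sub>R F i y) u = (\<Sum>i\<in>I. c i *\<^sub>R iter_pderiv is (F i) u)"
  using u
proof (induction "is" arbitrary: u)
  case Nil
  then show ?case by (simp add: iter_pderiv_def)
next
  case (Cons j "is")
  have d: "iter_pderiv is (F i) differentiable (at u)" if "i \<in> I" for i
    using F[OF that] Cons.prems unfolding smooth_on_def by blast
  have "dd (axis j 1) (iter_pderiv is (\<lambda>y. \<Sum>i\<in>I. c i *\<^sub>R F i y)) u
      = dd (axis j 1) (\<lambda>y. \<Sum>i\<in>I. c i *\<^sub>R iter_pderiv is (F i) y) u"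
    by (rule dd_cong_open[OF U Cons.prems Cons.IH])
  also have "\<dots> = (\<Sum>i\<in>I. dd (axis j 1) (\<lambda>y. c i *\<^sub>R iter_pderiv is (F i) y) u)"
    by (rule dd_sum) (simp add: d differentiable_scaleR)
  also have "\<dots> = (\<Sum>i\<in>I. c i *\<^sub>R dd (axis j 1) (iter_pderiv is (F i)) u)"
    by (rule sum.cong) (simp_all add: d dd_scaleR_const)
  finally show ?case unfolding iter_pderiv_Cons pderiv_dir_eq_dd .
qed

lemma smooth_on_sum_scaleR:
  assumes U: "open U" and F: "\<And>i. i \<in> I \<Longrightarrow> smooth_on U (F i)"
  shows "smooth_on U (\<lambda>y. \<Sum>i\<in>I. c i *\<^sub>R F i y)"
  unfolding smooth_on_def
proof (intro allI ballI)
  fix "is" u assume u: "u \<in> U"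
  have "(\<lambda>y. \<Sum>i\<in>I. c i *\<^sub>R iter_pderiv is (F i) y) differentiable (at u)"
    by (cases "finite I") (use F u in \<open>auto simp: smooth_on_def intro!: differentiable_sum differentiable_scaleR\<close>)
  then show "iter_pderiv is (\<lambda>y. \<Sum>i\<in>I. c i *\<^sub>R F i y) differentiable at u"
    using differentiable_cong_open[of U u "iter_pderiv is (\<lambda>y. \<Sum>i\<in>I. c i *\<^sub>R F i y)"
      "\<lambda>y. \<Sum>i\<in>I. c i *\<^sub>R iter_pderiv is (F i) y"]
      iter_pderiv_sum_scaleR[of U I F] U F u by blast
qed

text \<open>Smoothness is defined by coordinate directions. A fixed direction gives a combination of
  partial derivatives with constant coefficients, so closure under such combinations
  suffices.\<close>

lemma smooth_on_dd:
  assumes "open U" "smooth_on U F"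
  shows "smooth_on U (dd v F)"
proof (rule smooth_on_cong[OF assms(1)])
  show "dd v F y = (\<Sum>i\<in>UNIV. v $ i *\<^sub>R pderiv_dir i F y)" if "y \<in> U" for y
    using dd_eq_sum_pderiv_dir smooth_on_imp_differentiable[OF assms(2) that] by blast
  show "smooth_on U (\<lambda>y. \<Sum>i\<in>UNIV. v $ i *\<^sub>R pderiv_dir i F y)"
    by (intro smooth_on_sum_scaleR assms smooth_on_pderiv_dir)
qed

text \<open>The second difference quotient is symmetric in \<open>v\<close> and \<open>w\<close>; this makes second derivatives
  symmetric.\<close>

lemma second_difference_tendsto:
  fixes F :: "real^'m \<Rightarrow> real"
  assumes U: "open U" "u \<in> U" and F: "\<And>y. y \<in> U \<Longrightarrow> F differentiable (at y)"
    and d2: "dd v F differentiable (at u)"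
  shows "((\<lambda>t. (F (u + t *\<^sub>R v + t *\<^sub>R w) - F (u + t *\<^sub>R v) - F (u + t *\<^sub>R w) + F u) / t\<^sup>2)
            \<longlongrightarrow> dd w (dd v F) u) (at_right 0)"
proof (rule tendstoI)
  fix e :: real assume "e > 0"
  define L where "L = (\<lambda>h. dd h (dd v F) u)"
  \<comment> \<open>A displacement with both coefficients between \<open>0\<close> and
    \<open>t\<close> has norm at most \<open>t * b\<close>; the summand \<open>1\<close> keeps
    \<open>b\<close> positive when \<open>v\<close> and \<open>w\<close> vanish.\<close>
  define b where "b = norm v + norm w + 1"
  have b: "b > 0" by (simp add: b_def add_nonneg_pos)
  have linL: "linear L" unfolding L_def by (rule linear_dd[OF d2])
  \<comment> \<open>The linearization is used at two points, each with error at most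
    \<open>e' * (t * b)\<close>; together this is \<open>t * e / 2\<close>.\<close>
  define e' where "e' = e / (4 * b)"
  have "e' > 0" using \<open>e > 0\<close> b by (simp add: e'_def)
  have "(dd v F has_derivative L) (at u)" unfolding L_def by (rule has_derivative_dd[OF d2])
  then obtain d where d: "d > 0" "\<And>y. norm (y - u) < d \<Longrightarrow>
      norm (dd v F y - dd v F u - L (y - u)) \<le> e' * norm (y - u)"
    using \<open>e' > 0\<close> unfolding has_derivative_at_alt by blast
  obtain r where r: "r > 0" "ball u r \<subseteq> U" using U open_contains_ball by blast
  \<comment> \<open>Below \<open>t0\<close> all points involved lie in \<open>U\<close> and within
    the range of the linearization estimate.\<close>
  define t0 where "t0 = min d r / b"
  have t0: "t0 > 0" using d r b by (simp add: t0_def)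
  have main: "dist ((F (u + t *\<^sub>R v + t *\<^sub>R w) - F (u + t *\<^sub>R v) - F (u + t *\<^sub>R w) + F u) / t\<^sup>2)
      (dd w (dd v F) u) < e" if t: "0 < t" "t < t0" for t
  proof -
    have tb: "t * b < min d r" using t b by (simp add: t0_def field_simps)
    have small: "norm (x *\<^sub>R v + c *\<^sub>R w) \<le> t * b" if "0 \<le> x" "x \<le> t" "0 \<le> c" "c \<le> t" for x c
    proof -
      have "norm (x *\<^sub>R v + c *\<^sub>R w) \<le> x * norm v + c * norm w"
        using norm_triangle_ineq[of "x *\<^sub>R v" "c *\<^sub>R w"] that by simp
      also have "\<dots> \<le> t * norm v + t * norm w" using that by (intro add_mono mult_right_mono) auto
      also have "\<dots> \<le> t * b" using t by (simp add: b_def algebra_simps)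
      finally show ?thesis .
    qed
    have inU: "u + x *\<^sub>R v + c *\<^sub>R w \<in> U" if "0 \<le> x" "x \<le> t" "0 \<le> c" "c \<le> t" for x c
    proof -
      have "dist u (u + x *\<^sub>R v + c *\<^sub>R w) = norm (x *\<^sub>R v + c *\<^sub>R w)"
        using dist_add_cancel[of u 0 "x *\<^sub>R v + c *\<^sub>R w"] by (simp add: add.assoc)
      then have "u + x *\<^sub>R v + c *\<^sub>R w \<in> ball u r" using small[OF that] tb by simp
      then show ?thesis using r(2) by blast
    qed
    have der: "((\<lambda>x. F (u + x *\<^sub>R v + c *\<^sub>R w)) has_field_derivative
        dd v F (u + x *\<^sub>R v + c *\<^sub>R w)) (at x)"
      if "0 \<le> x" "x \<le> t" "0 \<le> c" "c \<le> t" for x c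
    proof -
      let ?p = "u + x *\<^sub>R v + c *\<^sub>R w"
      have 1: "((\<lambda>x. u + x *\<^sub>R v + c *\<^sub>R w) has_derivative (\<lambda>h. h *\<^sub>R v)) (at x)"
        by (auto intro!: derivative_eq_intros)
      have 2: "(F has_derivative (\<lambda>h. dd h F ?p)) (at ?p)"
        using has_derivative_dd F[OF inU[OF that]] by blast
      have "((\<lambda>x. F (u + x *\<^sub>R v + c *\<^sub>R w)) has_derivative (\<lambda>h. dd (h *\<^sub>R v) F ?p)) (at x)"
        by (rule has_derivative_compose[OF 1 2])
      moreover have "(\<lambda>h. dd (h *\<^sub>R v) F ?p) = (*) (dd v F ?p)"
        by (rule ext) (simp add: dd_scaleR_dir[OF F[OF inU[OF that]]])
      ultimately show ?thesis by (simp add: has_field_derivative_def)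
    qed
    \<comment> \<open>The mean value theorem is applied to the difference of two slices, so that a
      single \<xi> serves both. The contributions of \<open>v\<close> then cancel in the
      linearization and \<open>t * L w\<close> is left.\<close>
    define \<phi> where "\<phi> = (\<lambda>x. F (u + x *\<^sub>R v + t *\<^sub>R w) - F (u + x *\<^sub>R v + 0 *\<^sub>R w))"
    have "\<exists>\<xi>. 0 < \<xi> \<and> \<xi> < t \<and> \<phi> t - \<phi> 0 = (t - 0) *
        (dd v F (u + \<xi> *\<^sub>R v + t *\<^sub>R w) - dd v F (u + \<xi> *\<^sub>R v + 0 *\<^sub>R w))"
      unfolding \<phi>_def by (rule MVT2[OF t(1)], rule DERIV_diff[OF der der]) (use t in auto)
    then obtain \<xi> where xi: "0 < \<xi>" "\<xi> < t" "\<phi> t - \<phi> 0 = t *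
        (dd v F (u + \<xi> *\<^sub>R v + t *\<^sub>R w) - dd v F (u + \<xi> *\<^sub>R v + 0 *\<^sub>R w))"
      by auto
    have est: "\<bar>dd v F (u + \<xi> *\<^sub>R v + c *\<^sub>R w) - dd v F u - L (\<xi> *\<^sub>R v + c *\<^sub>R w)\<bar> \<le> e' * (t * b)"
      if "0 \<le> c" "c \<le> t" for c
    proof -
      have s: "norm (\<xi> *\<^sub>R v + c *\<^sub>R w) \<le> t * b" using small that xi by simp
      have "norm (\<xi> *\<^sub>R v + c *\<^sub>R w) < d" using s tb by simp
      then have "\<bar>dd v F (u + \<xi> *\<^sub>R v + c *\<^sub>R w) - dd v F u - L (\<xi> *\<^sub>R v + c *\<^sub>R w)\<bar>
          \<le> e' * norm (\<xi> *\<^sub>R v + c *\<^sub>R w)"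
        using d(2)[of "u + \<xi> *\<^sub>R v + c *\<^sub>R w"] by (simp add: algebra_simps)
      also have "\<dots> \<le> e' * (t * b)" using s \<open>e' > 0\<close> by simp
      finally show ?thesis .
    qed
    have "L (\<xi> *\<^sub>R v + t *\<^sub>R w) - L (\<xi> *\<^sub>R v + 0 *\<^sub>R w) = t * L w"
      using linL by (simp add: linear_add linear_scale)
    then have "\<bar>(dd v F (u + \<xi> *\<^sub>R v + t *\<^sub>R w) - dd v F (u + \<xi> *\<^sub>R v + 0 *\<^sub>R w)) - t * L w\<bar>
        \<le> 2 * (e' * (t * b))"
      using est[of t] est[of 0] t by linarith
    also have "2 * (e' * (t * b)) = t * e / 2" using b by (simp add: e'_def field_simps)
    finally have 3: "\<bar>(dd v F (u + \<xi> *\<^sub>R v + t *\<^sub>R w) - dd v F (u + \<xi> *\<^sub>R v + 0 *\<^sub>R w)) - t * L w\<bar>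
        \<le> t * e / 2" .
    have 4: "F (u + t *\<^sub>R v + t *\<^sub>R w) - F (u + t *\<^sub>R v) - F (u + t *\<^sub>R w) + F u = \<phi> t - \<phi> 0"
      by (simp add: \<phi>_def)
    have 5: "(\<phi> t - \<phi> 0) / t\<^sup>2 - L w =
       ((dd v F (u + \<xi> *\<^sub>R v + t *\<^sub>R w) - dd v F (u + \<xi> *\<^sub>R v + 0 *\<^sub>R w)) - t * L w) / t"
      unfolding xi(3) using t by (simp add: power2_eq_square field_simps)
    have "\<bar>(\<phi> t - \<phi> 0) / t\<^sup>2 - L w\<bar> \<le> e / 2"
      unfolding 5 using 3 t by (simp add: abs_divide field_simps)
    then show ?thesis unfolding 4 using \<open>e > 0\<close> by (simp add: dist_real_def L_def)
  qed
  show "\<forall>\<^sub>F t in at_right 0. dist ((F (u + t *\<^sub>R v + t *\<^sub>R w) - F (u + t *\<^sub>R v) - F (u + t *\<^sub>R w) + F u) / t\<^sup>2)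
      (dd w (dd v F) u) < e"
    unfolding eventually_at_right_field using main t0 by (intro exI[of _ t0]) auto
qed

text \<open>The mean value theorem behind the difference quotient needs real values, so the identity
  is tested on the components along \<open>Basis\<close>. There both mixed derivatives are limits of
  one and the same quotient.\<close>

lemma dd_commute:
  fixes F :: "real^'m \<Rightarrow> 'e::euclidean_space"
  assumes U: "open U" "u \<in> U" and F: "smooth_on U F"
  shows "dd v (dd w F) u = dd w (dd v F) u"
proof (rule euclidean_eqI)
  fix b :: 'e assume "b \<in> Basis"
  define G where "G = (\<lambda>y. F y \<bullet> b)"
  have dF: "F differentiable (at y)" if "y \<in> U" for y
    using smooth_on_imp_differentiable[OF F that] .
  have dG: "G differentiable (at y)" if "y \<in> U" for y
    unfolding G_def using dF[OF that] by simp
  have dG': "dd x G y = dd x F y \<bullet> b" if "y \<in> U" for x y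
    unfolding G_def using dd_apply_bounded_linear[OF bounded_linear_inner_left dF[OF that]] .
  have ddF: "dd x F differentiable (at u)" for x
    using smooth_on_imp_differentiable[OF smooth_on_dd[OF U(1) F] U(2)] .
  have ddG: "dd x G differentiable (at u)" for x
    using differentiable_cong_open[OF U dG'] ddF by simp
  have ddG': "dd x (dd z G) u = dd x (dd z F) u \<bullet> b" for x z
    by (subst dd_cong_open[OF U dG'])
      (auto intro: dd_apply_bounded_linear[OF bounded_linear_inner_left ddF])
  have 1: "((\<lambda>t. (G (u + t *\<^sub>R v + t *\<^sub>R w) - G (u + t *\<^sub>R v) - G (u + t *\<^sub>R w) + G u) / t\<^sup>2)
            \<longlongrightarrow> dd w (dd v G) u) (at_right 0)"
    by (rule second_difference_tendsto[OF U dG ddG])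
  have 2: "((\<lambda>t. (G (u + t *\<^sub>R w + t *\<^sub>R v) - G (u + t *\<^sub>R w) - G (u + t *\<^sub>R v) + G u) / t\<^sup>2)
            \<longlongrightarrow> dd v (dd w G) u) (at_right 0)"
    by (rule second_difference_tendsto[OF U dG ddG])
  have "dd v (dd w G) u = dd w (dd v G) u"
    by (rule tendsto_unique[OF _ 2]) (use 1 in \<open>simp_all add: algebra_simps\<close>)
  then show "dd v (dd w F) u \<bullet> b = dd w (dd v F) u \<bullet> b" by (simp add: ddG')
qed

section \<open>Traces and eigenvalues\<close>

lemma matrix_inv_cancel:
  fixes A :: "real^'n^'n"
  assumes "invertible A"
  shows "A ** matrix_inv A = mat 1" "matrix_inv A ** A = mat 1"
proof -
  have "A ** matrix_inv A = mat 1 \<and> matrix_inv A ** A = mat 1"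
    unfolding matrix_inv_def by (rule someI_ex) (use assms in \<open>simp add: invertible_def\<close>)
  then show "A ** matrix_inv A = mat 1" "matrix_inv A ** A = mat 1" by auto
qed

lemma trace_matrix: "trace (matrix L) = (\<Sum>i\<in>UNIV. L (axis i 1) $ i)"
  by (simp add: trace_def matrix_def)

lemma trace_matrix_ident: "trace (matrix (\<lambda>v::real^'m. v)) = real CARD('m)"
  by (simp add: trace_matrix)

lemma trace_matrix_add: "trace (matrix (\<lambda>v. L v + M v)) = trace (matrix L) + trace (matrix M)"
  by (simp add: trace_matrix sum.distrib)

lemma trace_matrix_diff:
  fixes L :: "real^'m \<Rightarrow> real^'m"
  shows "trace (matrix (\<lambda>v. L v - M v)) = trace (matrix L) - trace (matrix M)"
  by (simp add: trace_matrix sum_subtractf)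

lemma trace_matrix_scaleR:
  "trace (matrix (\<lambda>v. c *\<^sub>R L v)) = (c::real) * trace (matrix L)"
  by (simp add: trace_matrix sum_distrib_left)

section \<open>Raising indices and metric traces\<close>

lemma sharp_eqI:
  assumes "invertible (g u)" "(\<chi> j. \<alpha> (axis j 1)) = g u *v r"
  shows "sharp g u \<alpha> = r"
  unfolding sharp_def assms(2)
  by (simp add: matrix_vector_mul_assoc matrix_inv_cancel assms)

text \<open>Contraction with the inverse metric undoes the metric that lowers the index of
  \<open>L\<close>. The fixed vector \<open>c\<close> lets vector-valued forms be treated in the
  same way.\<close>

lemma metric_trace_eq_trace:
  fixes b :: "real^'m \<Rightarrow> real^'m \<Rightarrow> 'e::real_vector"
  assumes inv: "invertible (g u)" and sym: "transpose (g u) = g u"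
    and b: "\<And>i j. b (axis i 1) (axis j 1) = (g u *v L (axis i 1)) $ j *\<^sub>R c"
  shows "metric_trace g u b = trace (matrix L) *\<^sub>R c"
proof -
  have gs: "g u $ j $ k = g u $ k $ j" for j k
    using sym by (simp add: transpose_def vec_eq_iff)
  have "metric_trace g u b =
      (\<Sum>i\<in>UNIV. (\<Sum>j\<in>UNIV. matrix_inv (g u) $ i $ j * (g u *v L (axis i 1)) $ j)) *\<^sub>R c"
    by (simp add: metric_trace_def b scaleR_left.sum)
  also have "(\<lambda>i. \<Sum>j\<in>UNIV. matrix_inv (g u) $ i $ j * (g u *v L (axis i 1)) $ j)
      = (\<lambda>i. (matrix_inv (g u) *v (g u *v L (axis i 1))) $ i)"
    by (simp add: matrix_vector_mult_def)
  also have "\<dots> = (\<lambda>i. L (axis i 1) $ i)"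
    by (simp add: matrix_vector_mul_assoc matrix_inv_cancel inv)
  finally show ?thesis by (simp add: trace_matrix)
qed

section \<open>Differentiability of solutions of linear systems\<close>

lemma differentiable_prod:
  fixes f :: "'i \<Rightarrow> 'a::real_normed_vector \<Rightarrow> real"
  assumes "\<And>i. i \<in> I \<Longrightarrow> f i differentiable (at x)"
  shows "(\<lambda>x. \<Prod>i\<in>I. f i x) differentiable (at x)"
  by (rule differentiableI[OF has_derivative_prod])
    (use assms in \<open>simp add: frechet_derivative_works\<close>)

lemma differentiable_det:
  fixes M :: "'a::real_normed_vector \<Rightarrow> real^'n^'n"
  assumes "\<And>i j. (\<lambda>y. M y $ i $ j) differentiable (at u)"
  shows "(\<lambda>y. det (M y)) differentiable (at u)"
  unfolding det_def
  by (intro differentiable_sum differentiable_mult differentiable_prod differentiable_const ballI assms)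
    (simp add: finite_permutations)

lemma differentiable_vecI:
  fixes F :: "'a::real_normed_vector \<Rightarrow> real^'n"
  assumes "\<And>i. (\<lambda>y. F y $ i) differentiable (at u)"
  shows "F differentiable (at u)"
proof -
  have "F = (\<lambda>y. \<Sum>i\<in>UNIV. F y $ i *\<^sub>R axis i 1)"
    by (rule ext) (simp add: basis_expansion flip: scalar_mult_eq_scaleR)
  moreover have "\<dots> differentiable (at u)"
    by (intro differentiable_sum differentiable_scaleR differentiable_const ballI assms) simp
  ultimately show ?thesis by simp
qed

text \<open>By Cramer's rule.\<close>

lemma differentiable_linear_solution:
  fixes M :: "'a::real_normed_vector \<Rightarrow> real^'n^'n"
  assumes U: "open U" "u \<in> U"
    and M: "\<And>i j. (\<lambda>y. M y $ i $ j) differentiable (at u)"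
    and b: "\<And>i. (\<lambda>y. b y $ i) differentiable (at u)"
    and inv: "\<And>y. y \<in> U \<Longrightarrow> invertible (M y)"
    and x: "\<And>y. y \<in> U \<Longrightarrow> M y *v x y = b y"
  shows "x differentiable (at u)"
proof (rule differentiable_vecI)
  fix k
  define C where "C = (\<lambda>y. det (\<chi> i j. if j = k then b y $ i else M y $ i $ j))"
  have det: "det (M y) \<noteq> 0" if "y \<in> U" for y
    using inv[OF that] by (simp add: invertible_det_nz)
  have eq: "x y $ k = C y / det (M y)" if "y \<in> U" for y
    using cramer[OF det[OF that], of "x y" "b y"] x[OF that] by (simp add: C_def)
  have "C differentiable (at u)"
    unfolding C_def
  proof (rule differentiable_det)
    show "(\<lambda>y. (\<chi> i j. if j = k then b y $ i else M y $ i $ j) $ i $ j) differentiable at u" for i j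
      by (cases "j = k") (simp_all add: M b)
  qed
  moreover have "(\<lambda>y. det (M y)) differentiable (at u)" by (rule differentiable_det[OF M])
  ultimately have "(\<lambda>y. C y / det (M y)) differentiable (at u)"
    using det[OF U(2)] by (simp add: divide_inverse differentiable_mult differentiable_inverse)
  then show "(\<lambda>y. x y $ k) differentiable (at u)"
    unfolding differentiable_def
    using has_derivative_transform_within_open[OF _ U] eq by (metis (no_types, lifting))
qed

section \<open>Traces computed from eigenvalues\<close>

lemma trace_eq_sum_eigenbasis:
  fixes L :: "real^'m \<Rightarrow> real^'m"
  assumes L: "linear L" and B: "independent B" "card B = CARD('m)"
    and ev: "\<And>b. b \<in> B \<Longrightarrow> L b = c b *\<^sub>R b"
  shows "trace (matrix L) = (\<Sum>b\<in>B. c b)"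
proof -
  have "finite B" using B(1) by (rule independent_imp_finite)
  then obtain h where h: "bij_betw h (UNIV :: 'm set) B"
    using finite_same_card_bij[of "UNIV :: 'm set" B] B by auto
  \<comment> \<open>The columns of \<open>S\<close> are the eigenvectors, so that \<open>S\<close>
    conjugates \<open>matrix L\<close> into the diagonal matrix \<open>D\<close> below; independence
    of the columns makes \<open>S\<close> invertible.\<close>
  define S :: "real^'m^'m" where "S = (\<chi> i j. h j $ i)"
  have col: "column j S = h j" for j by (simp add: column_def S_def vec_eq_iff)
  have "\<exists>T. T ** S = mat 1"
    unfolding matrix_left_invertible_independent_columns
  proof (intro allI impI)
    fix d i assume "(\<Sum>i\<in>UNIV. d i *s column i S) = 0"
    then have 1: "(\<Sum>i\<in>UNIV. d i *\<^sub>R h i) = 0" by (simp add: col scalar_mult_eq_scaleR)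
    have "(\<Sum>i\<in>UNIV. d i *\<^sub>R h i) = (\<Sum>b\<in>B. d (inv h b) *\<^sub>R b)"
      by (rule sum.reindex_bij_betw[OF h, of "\<lambda>b. d (inv h b) *\<^sub>R b", symmetric, THEN trans, symmetric])
        (use h in \<open>simp add: bij_betw_def\<close>)
    with 1 have "(\<Sum>b\<in>B. d (inv h b) *\<^sub>R b) = 0" by simp
    moreover have "h i \<in> B" using h by (auto simp: bij_betw_def)
    ultimately have "d (inv h (h i)) = 0"
      using B(1) \<open>finite B\<close> independentD[of B B "\<lambda>b. d (inv h b)" "h i"] by auto
    then show "d i = 0" using h by (simp add: bij_betw_def)
  qed
  then obtain T where T: "T ** S = mat 1" by blast
  then have T': "S ** T = mat 1" using matrix_left_right_inverse by blast
  define D :: "real^'m^'m" where "D = (\<chi> i j. if i = j then c (h j) else 0)"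
  have "matrix L ** S = S ** D"
  proof -
    have "(matrix L ** S) $ i $ j = (S ** D) $ i $ j" for i j
    proof -
      have "(matrix L ** S) $ i $ j = (matrix L *v h j) $ i"
        by (simp add: matrix_matrix_mult_def matrix_vector_mult_def S_def)
      also have "\<dots> = L (h j) $ i" using matrix_works[OF linear_matrix_vector_mul_eq[THEN iffD2, OF L]]
        by (simp add: matrix_works L)
      also have "\<dots> = c (h j) * h j $ i" using ev[of "h j"] h by (auto simp: bij_betw_def)
      also have "\<dots> = (S ** D) $ i $ j"
        by (simp add: matrix_matrix_mult_def D_def S_def if_distrib[of "\<lambda>z. _ * z"] cong: if_cong)
      finally show ?thesis .
    qed
    then show ?thesis by (simp add: vec_eq_iff)
  qed
  then have "matrix L = (S ** D) ** T"
    by (metis T' matrix_mul_assoc matrix_mul_rid)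
  then have "trace (matrix L) = trace (T ** (S ** D))" using trace_mul_sym by metis
  also have "\<dots> = trace D" by (simp add: matrix_mul_assoc T)
  also have "\<dots> = (\<Sum>i\<in>UNIV. c (h i))" by (simp add: trace_def D_def)
  also have "\<dots> = (\<Sum>b\<in>B. c b)" by (rule sum.reindex_bij_betw[OF h])
  finally show ?thesis .
qed

text \<open>Applying \<open>A\<close> minus \<open>j\<close> times the identity removes
  \<open>x j\<close> and multiplies every other term by the nonzero number \<open>k - j\<close>. The
  rescaled vectors are again eigenvectors, which is why the induction varies
  \<open>x\<close>.\<close>

lemma eigenvectors_sum_eq_0:
  fixes A :: "'v::real_vector \<Rightarrow> 'v"
  assumes "linear A" "finite K"
    and "\<And>k. k \<in> K \<Longrightarrow> A (x k) = k *\<^sub>R x k" and "(\<Sum>k\<in>K. x k) = 0"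
  shows "\<forall>k\<in>K. x k = 0"
  using assms(2-)
proof (induction K arbitrary: x rule: finite_induct)
  case (insert j K)
  have 0: "x j + (\<Sum>k\<in>K. x k) = 0" using insert by simp
  then have "A (x j + (\<Sum>k\<in>K. x k)) = 0" using linear_0[OF assms(1)] by simp
  then have 1: "j *\<^sub>R x j + (\<Sum>k\<in>K. k *\<^sub>R x k) = 0"
    using insert.prems(1) by (simp add: linear_add linear_sum assms(1))
  have "(\<Sum>k\<in>K. (k - j) *\<^sub>R x k) = (\<Sum>k\<in>K. k *\<^sub>R x k) - j *\<^sub>R (\<Sum>k\<in>K. x k)"
    by (simp add: scaleR_diff_left sum_subtractf scaleR_sum_right)
  also have "\<dots> = 0"
    using 0 1 by (metis add.commute add_diff_cancel_left' add_eq_0_iff diff_0 minus_diff_eq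
        scaleR_minus_right)
  finally have "\<forall>k\<in>K. (k - j) *\<^sub>R x k = 0"
    using insert.prems(1) by (intro insert.IH) (auto simp: linear_scale[OF assms(1)])
  then have "\<forall>k\<in>K. x k = 0" using insert.hyps(2) by auto
  then show ?case using 0 by simp
qed simp

text \<open>Diagonalizability is obtained by counting: bases of the eigenspaces are disjoint and
  jointly independent, and the dimensions make their union a basis. Later \<open>L\<close> is a
  power of the shape operator and \<open>h\<close> the same power of the eigenvalue.\<close>

lemma trace_eq_sum_eigenvalues:
  fixes A L :: "real^'m \<Rightarrow> real^'m"
  assumes A: "linear A" and K: "finite K"
    and dim: "(\<Sum>k\<in>K. dim {v. A v = k *\<^sub>R v}) = CARD('m)"
    and L: "linear L" and LA: "\<And>k v. k \<in> K \<Longrightarrow> A v = k *\<^sub>R v \<Longrightarrow> L v = h k *\<^sub>R v"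
  shows "trace (matrix L) = (\<Sum>k\<in>K. real (dim {v. A v = k *\<^sub>R v}) * h k)"
proof -
  have "\<forall>k. \<exists>B. B \<subseteq> {v. A v = k *\<^sub>R v} \<and> independent B \<and> card B = dim {v. A v = k *\<^sub>R v}"
    by (meson basis_exists)
  then obtain B where B: "\<And>k. B k \<subseteq> {v. A v = k *\<^sub>R v}" "\<And>k. independent (B k)"
      "\<And>k. card (B k) = dim {v. A v = k *\<^sub>R v}"
    by metis
  have fin: "finite (B k)" for k using B(2) independent_imp_finite by blast
  have nz: "b \<noteq> 0" if "b \<in> B k" for b k using B(2)[of k] that dependent_zero by blast
  have disj: "B j \<inter> B k = {}" if "j \<noteq> k" for j k
  proof -
    have False if "b \<in> B j" "b \<in> B k" for b
    proof -
      have "A b = j *\<^sub>R b" "A b = k *\<^sub>R b" using B(1) that by blast+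
      then have "j *\<^sub>R b = k *\<^sub>R b" by metis
      then show False using \<open>j \<noteq> k\<close> nz[OF that(1)] scaleR_right_imp_eq by blast
    qed
    then show ?thesis by blast
  qed
  define C where "C = (\<Union>k\<in>K. B k)"
  have finC: "finite C" using K fin by (simp add: C_def)
  have sumC: "sum F C = (\<Sum>k\<in>K. sum F (B k))" for F :: "real^'m \<Rightarrow> 'w::comm_monoid_add"
    unfolding C_def by (rule sum.UNION_disjoint) (use K fin disj in auto)
  have ind: "independent C"
  proof (rule independent_if_scalars_zero[OF finC])
    fix d b assume 0: "(\<Sum>x\<in>C. d x *\<^sub>R x) = 0" and "b \<in> C"
    then obtain k where k: "k \<in> K" "b \<in> B k" by (auto simp: C_def)
    have "\<forall>k\<in>K. (\<Sum>x\<in>B k. d x *\<^sub>R x) = 0"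
    proof (rule eigenvectors_sum_eq_0[OF A K])
      show "A (\<Sum>x\<in>B k. d x *\<^sub>R x) = k *\<^sub>R (\<Sum>x\<in>B k. d x *\<^sub>R x)" for k
        using B(1)[of k] by (auto simp: linear_sum[OF A] linear_scale[OF A] scaleR_sum_right intro!: sum.cong)
      show "(\<Sum>k\<in>K. \<Sum>x\<in>B k. d x *\<^sub>R x) = 0" using 0 sumC by metis
    qed
    then show "d b = 0" using independentD[OF B(2) fin _ _ k(2)] k(1) by blast
  qed
  have cardC: "card C = CARD('m)"
    using sumC[of "\<lambda>_. 1::nat"] dim by (simp add: B(3))
  \<comment> \<open>A basis vector is nonzero and so determines its eigenvalue; this makes the
    eigenvalue a function on the union of the bases.\<close>
  define ev where "ev = (\<lambda>b. SOME k. A b = k *\<^sub>R b)"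
  have ev: "ev b = k" if "b \<in> B k" for b k
  proof -
    have "A b = k *\<^sub>R b" using B(1) that by blast
    moreover from this have "A b = ev b *\<^sub>R b" unfolding ev_def by (rule someI)
    ultimately have "ev b *\<^sub>R b = k *\<^sub>R b" by simp
    then show ?thesis using nz[OF that] scaleR_right_imp_eq by blast
  qed
  have "trace (matrix L) = (\<Sum>b\<in>C. h (ev b))"
  proof (rule trace_eq_sum_eigenbasis[OF L ind cardC])
    show "L b = h (ev b) *\<^sub>R b" if "b \<in> C" for b
      using that B(1) LA ev unfolding C_def by blast
  qed
  also have "\<dots> = (\<Sum>k\<in>K. real (dim {v. A v = k *\<^sub>R v}) * h k)"
    unfolding sumC using ev by (simp flip: B(3))
  finally show ?thesis .
qed

lemma inner_metric_trace: "metric_trace g u b \<bullet> x = metric_trace g u (\<lambda>v w. b v w \<bullet> x)"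
  by (simp add: metric_trace_def inner_sum_left)

lemma metric_trace_scaleR:
  "metric_trace g u (\<lambda>v w. c *\<^sub>R b v w) = c *\<^sub>R metric_trace g u b"
  by (simp add: metric_trace_def scaleR_sum_right mult.commute)

lemma metric_trace_0: "metric_trace g u (\<lambda>v w. 0) = 0"
  by (simp add: metric_trace_def)

lemma trace_matrix_rank_one:
  fixes \<alpha> :: "real^'m \<Rightarrow> real"
  assumes "linear \<alpha>"
  shows "trace (matrix (\<lambda>z. \<alpha> z *\<^sub>R c)) = \<alpha> c"
  using linear_eq_sum_axis[OF assms, of c] by (simp add: trace_matrix mult.commute)

lemma trace_matrix_comp_commute:
  fixes L M :: "real^'m \<Rightarrow> real^'m"
  assumes "linear L" "linear M"
  shows "trace (matrix (\<lambda>v. L (M v))) = trace (matrix (\<lambda>v. M (L v)))"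
  using matrix_compose[OF assms] matrix_compose[OF assms(2,1)]
    trace_mul_sym[of "matrix L" "matrix M"] by (simp add: comp_def)

lemma differentiable_vec_nth:
  "F differentiable (at u) \<Longrightarrow> (\<lambda>y. F y $ i) differentiable (at u)"
  unfolding differentiable_def by (blast intro: bounded_linear.has_derivative[OF bounded_linear_vec_nth])

section \<open>Curvature of the sphere\<close>

lemma has_derivative_sphere_proj:
  "((\<lambda>q. sphere_proj q v) has_derivative (\<lambda>h. - (v \<bullet> h) *\<^sub>R p - (v \<bullet> p) *\<^sub>R h)) (at p)"
  unfolding sphere_proj_def by (auto intro!: derivative_eq_intros simp: algebra_simps)

lemma dd_sphere_proj: "dd h (\<lambda>q. sphere_proj q v) p = - (v \<bullet> h) *\<^sub>R p - (v \<bullet> p) *\<^sub>R h"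
  by (rule dd_eqI[OF has_derivative_sphere_proj])

lemma sphere_conn_eq: "sphere_conn X Y p = sphere_proj p (dd (X p) Y p)"
  by (simp add: sphere_conn_def dd_def)

text \<open>The value is needed at all ambient points near the sphere, because it is differentiated
  once more. The terms are grouped by the factors \<open>q \<bullet> q - 1\<close> and
  \<open>z \<bullet> q\<close>: both vanish at a point \<open>p\<close> of the sphere to which
  \<open>z\<close> is tangent, so only these factors have to be differentiated there.\<close>

lemma sphere_conn_sphere_proj:
  "sphere_conn (\<lambda>q. sphere_proj q w) (\<lambda>q. sphere_proj q z) q =
     ((z \<bullet> w - (w \<bullet> q) * (z \<bullet> q)) * (q \<bullet> q - 1)) *\<^sub>R q
       - (z \<bullet> q) *\<^sub>R (w - ((w \<bullet> q) * (2 - q \<bullet> q)) *\<^sub>R q)"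
proof -
  define a b c d where "a = w \<bullet> q" "b = z \<bullet> q" "c = q \<bullet> q" "d = z \<bullet> w"
  note defs = this
  have "sphere_conn (\<lambda>q. sphere_proj q w) (\<lambda>q. sphere_proj q z) q
      = - (d - a * b) *\<^sub>R q - b *\<^sub>R (w - a *\<^sub>R q)
        - (- (d - a * b) * c - b * (a - a * c)) *\<^sub>R q"
    unfolding sphere_conn_eq dd_sphere_proj by (simp add: sphere_proj_def inner_simps defs)
  also have "\<dots> = (- (d - a * b) + b * a - (- (d - a * b) * c - b * (a - a * c))) *\<^sub>R q - b *\<^sub>R w"
    by (simp only: scaleR_left_distrib scaleR_left_diff_distrib scaleR_right_diff_distrib scaleR_scaleR)
      simp
  also have "- (d - a * b) + b * a - (- (d - a * b) * c - b * (a - a * c))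
      = (d - a * b) * (c - 1) + b * (a * (2 - c))"
    by algebra
  also have "\<dots> *\<^sub>R q - b *\<^sub>R w = ((d - a * b) * (c - 1)) *\<^sub>R q - b *\<^sub>R (w - (a * (2 - c)) *\<^sub>R q)"
    by (simp only: scaleR_left_distrib scaleR_right_diff_distrib scaleR_scaleR) simp
  finally show ?thesis by (simp only: defs)
qed

lemma sphere_conn_conn_sphere_proj:
  assumes "p \<bullet> p = 1" "v \<bullet> p = 0" "w \<bullet> p = 0" "z \<bullet> p = 0"
  shows "sphere_conn (\<lambda>q. sphere_proj q v)
     (sphere_conn (\<lambda>q. sphere_proj q w) (\<lambda>q. sphere_proj q z)) p = - (z \<bullet> v) *\<^sub>R w"
proof -
  note perp = assms assms(2-4)[unfolded inner_commute[of _ p]]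
  have "(sphere_conn (\<lambda>q. sphere_proj q w) (\<lambda>q. sphere_proj q z) has_derivative
      (\<lambda>h. ((z \<bullet> w) * (p \<bullet> h + h \<bullet> p)) *\<^sub>R p - (z \<bullet> h) *\<^sub>R w)) (at p)"
    unfolding sphere_conn_sphere_proj[abs_def]
    by (auto intro!: derivative_eq_intros simp: perp)
  from dd_eqI[OF this, of v] show ?thesis
    using assms by (simp add: sphere_conn_eq) (simp add: sphere_proj_def perp)
qed

text \<open>The chosen extensions have vanishing Lie bracket at \<open>p\<close>, so the third term
  of the curvature drops out and the two iterated derivatives give constant curvature 1.\<close>

lemma sphere_curvature_eq:
  assumes "p \<bullet> p = 1" "v \<bullet> p = 0" "w \<bullet> p = 0" "z \<bullet> p = 0"
  shows "sphere_curvature p v w z = (w \<bullet> z) *\<^sub>R v - (v \<bullet> z) *\<^sub>R w"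
proof -
  note perp = assms assms(2-4)[unfolded inner_commute[of _ p]]
  have L: "lie_bracket (\<lambda>q. sphere_proj q v) (\<lambda>q. sphere_proj q w) p = 0"
    unfolding lie_bracket_def dd_def[symmetric] dd_sphere_proj
    by (simp add: sphere_proj_def perp inner_commute[of v w])
  have "sphere_conn (lie_bracket (\<lambda>q. sphere_proj q v) (\<lambda>q. sphere_proj q w))
      (\<lambda>q. sphere_proj q z) p = sphere_proj p 0"
    unfolding sphere_conn_eq L dd_sphere_proj by simp
  then show ?thesis
    unfolding sphere_curvature_def curvature_def
      sphere_conn_conn_sphere_proj[OF assms(1,2,3,4)] sphere_conn_conn_sphere_proj[OF assms(1,3,2,4)]
    by (simp add: inner_commute) (simp add: sphere_proj_def)
qed

section \<open>The cubic equation\<close>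

text \<open>The first two alternatives leave a single sign change among the coefficients, as in
  Descartes' rule. The third says that the derivative has negative discriminant, so that the cubic
  is strictly monotone.\<close>

lemma cubic_unique_pos_root:
  fixes a b c d :: real
  assumes a: "a < 0" and d: "d > 0" and bc: "c \<ge> 0 \<or> b \<le> 0 \<or> b\<^sup>2 < 3 * a * c"
  shows "\<exists>!u. u > 0 \<and> a * u ^ 3 + b * u\<^sup>2 + c * u + d = 0"
proof -
  define P where "P = (\<lambda>u. a * u ^ 3 + b * u\<^sup>2 + c * u + d)"
  \<comment> \<open>Since \<open>v\<close> is at least \<open>1\<close>, the lower terms are at most
    \<open>(\<bar>b\<bar> + \<bar>c\<bar> + d) * v\<^sup>2\<close>. This value makes the leading
    term cancel that bound and leave \<open>a * v\<^sup>2 < 0\<close>.\<close>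
  define v where "v = 1 + (\<bar>b\<bar> + \<bar>c\<bar> + d) / (- a)"
  have "(\<bar>b\<bar> + \<bar>c\<bar> + d) / (- a) \<ge> 0" using a d by (intro divide_nonneg_pos) auto
  then have v: "v \<ge> 1" by (simp add: v_def)
  have "P v \<le> a * v ^ 3 + \<bar>b\<bar> * v\<^sup>2 + \<bar>c\<bar> * v\<^sup>2 + d * v\<^sup>2"
  proof -
    have "v * 1 \<le> v * v" using v by (intro mult_left_mono) auto
    then have v2: "v \<le> v\<^sup>2" by (simp add: power2_eq_square)
    have "b * v\<^sup>2 \<le> \<bar>b\<bar> * v\<^sup>2" by (intro mult_right_mono) auto
    moreover have "c * v \<le> \<bar>c\<bar> * v" using v by (intro mult_right_mono) auto
    moreover have "\<bar>c\<bar> * v \<le> \<bar>c\<bar> * v\<^sup>2" using v2 by (intro mult_left_mono) auto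
    moreover have "d * 1 \<le> d * v\<^sup>2" using v v2 d by (intro mult_left_mono) auto
    ultimately show ?thesis by (simp add: P_def)
  qed
  also have "\<dots> = a * v\<^sup>2"
    using a by (simp add: v_def field_simps power2_eq_square power3_eq_cube)
  also have "\<dots> < 0" using a v by (simp add: mult_neg_pos)
  finally have "P v < 0" .
  have "\<exists>u\<ge>0. u \<le> v \<and> P u = 0"
    by (rule IVT2) (use \<open>P v < 0\<close> d v in \<open>auto simp: P_def\<close>)
  then obtain u where u: "u > 0" "P u = 0"
    using d by (metis P_def add_0 less_eq_real_def less_irrefl mult_zero_right power_zero_numeral)
  have False if xy: "0 < x" "x < y" and P: "P x = 0" "P y = 0" for x y
    using bc
  proof (elim disjE)
    assume "c \<ge> 0"
    \<comment> \<open>The combination \<open>y\<^sup>2 * P x - x\<^sup>2 * P y\<close> is chosen to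
      eliminate \<open>b\<close>, whose sign is unknown in this case.\<close>
    have "0 < (y - x) * (- a * x\<^sup>2 * y\<^sup>2 + c * x * y + d * (x + y))"
      using a d xy \<open>c \<ge> 0\<close>
      by (intro mult_pos_pos add_nonneg_pos add_nonneg_nonneg mult_nonneg_nonneg) auto
    also have "\<dots> = y\<^sup>2 * P x - x\<^sup>2 * P y" unfolding P_def by algebra
    finally show False using P by simp
  next
    assume "b \<le> 0"
    \<comment> \<open>Here the combination \<open>y * P x - x * P y\<close> eliminates
      \<open>c\<close>.\<close>
    have "0 < (y - x) * (- a * x * y * (x + y) + (- b) * x * y + d)"
      using a d xy \<open>b \<le> 0\<close>
      by (intro mult_pos_pos add_nonneg_pos add_nonneg_nonneg mult_nonneg_nonneg) auto
    also have "\<dots> = y * P x - x * P y" unfolding P_def by algebra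
    finally show False using P by simp
  next
    assume bc: "b\<^sup>2 < 3 * a * c"
    \<comment> \<open>\<open>Q\<close> is the divided difference of \<open>P\<close> at
      \<open>x\<close> and \<open>y\<close>; completing squares shows that it has the sign of
      \<open>a\<close>.\<close>
    define Q where "Q = a * (x\<^sup>2 + x * y + y\<^sup>2) + b * (x + y) + c"
    have "4 * (3 * a) * Q = 3 * a\<^sup>2 * (x - y)\<^sup>2 + (3 * a * (x + y) + 2 * b)\<^sup>2 + 4 * (3 * a * c - b\<^sup>2)"
      unfolding Q_def by algebra
    moreover have "\<dots> > 0" using bc by (intro add_nonneg_pos) auto
    ultimately have "Q \<noteq> 0" by auto
    moreover have "P y - P x = (y - x) * Q" unfolding P_def Q_def by algebra
    ultimately show False using P xy by simp
  qed
  then have "v = u" if "v > 0" "P v = 0" for v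
    using that u by (metis linorder_neqE_linordered_idom)
  then show ?thesis using u unfolding P_def by blast
qed

text \<open>The coefficients of the cubic in \<open>u = (2 cot 2s)\<^sup>2\<close> to which the \<open>c\<close>-biharmonic
  equation reduces. The middle coefficients have signs allowing three positive roots only for
  \<open>(m\<^sub>1, m\<^sub>2) = (1, 2), (2, 3), (3, 4)\<close>.\<close>

lemma multiplicity_cubic_unique_pos_root:
  fixes m\<^sub>1 m\<^sub>2 :: nat
  defines "x \<equiv> real m\<^sub>1" and "y \<equiv> real m\<^sub>2"
  assumes m: "0 < m\<^sub>1" "m\<^sub>1 < m\<^sub>2"
  shows "\<exists>!u. u > 0 \<and> - x * (2 * x\<^sup>2 - 5 * x + 6) * u ^ 3
     + x * (32 * x + 12 * y - 24 - 8 * (x\<^sup>2 + y\<^sup>2 - x * y)) * u\<^sup>2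
     + y * (32 * (x\<^sup>2 + y\<^sup>2 - x * y) - 48 * x - 128 * y + 96) * u
     + 64 * y * (2 * y\<^sup>2 - 5 * y + 6) = 0"
proof (rule cubic_unique_pos_root)
  have q: "2 * t\<^sup>2 - 5 * t + 6 > 0" for t :: real
  proof -
    have "2 * t\<^sup>2 - 5 * t + 6 = 2 * (t - 5 / 4)\<^sup>2 + 23 / 8" by algebra
    then show ?thesis by (metis add_nonneg_pos divide_pos_pos mult_nonneg_nonneg zero_le_power2
          zero_less_numeral zero_le_numeral)
  qed
  have pos: "x > 0" "y > 0" using m by (auto simp: x_def y_def)
  show "- x * (2 * x\<^sup>2 - 5 * x + 6) < 0" using q[of x] pos by (simp add: mult_pos_pos)
  show "64 * y * (2 * y\<^sup>2 - 5 * y + 6) > 0" using q[of y] pos by simp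
  let ?b = "32 * x + 12 * y - 24 - 8 * (x\<^sup>2 + y\<^sup>2 - x * y)"
  let ?c = "32 * (x\<^sup>2 + y\<^sup>2 - x * y) - 48 * x - 128 * y + 96"
  show "y * ?c \<ge> 0 \<or> x * ?b \<le> 0 \<or> (x * ?b)\<^sup>2 < 3 * (- x * (2 * x\<^sup>2 - 5 * x + 6)) * (y * ?c)"
  proof (cases "?c \<ge> 0 \<or> ?b \<le> 0")
    case True
    then show ?thesis using pos by (auto simp: mult_nonneg_nonpos)
  next
    case False
    then have b: "?b > 0" and c: "?c < 0" by auto
    \<comment> \<open>In terms of \<open>k\<close> the form
      \<open>x\<^sup>2 + y\<^sup>2 - x * y\<close> is \<open>x\<^sup>2 + k * x + k\<^sup>2\<close>,
      and \<open>?b\<close> is a concave quadratic in \<open>x\<close>. Among positive integers only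
      \<open>k = 1\<close> makes its maximum positive.\<close>
    define k where "k = y - x"
    have k1: "k \<ge> 1" using m by (simp add: k_def x_def y_def)
    have "?b = - 8 * (x + (k - 11 / 2) / 2)\<^sup>2 - 2 * (3 * k\<^sup>2 + 5 * k - 73 / 4)"
      unfolding k_def by (simp add: power2_eq_square field_simps)
    moreover have "W < 0" if "?b = - 8 * Z\<^sup>2 - 2 * W" for Z W
    proof -
      have "- 8 * Z\<^sup>2 \<le> 0" by simp
      then show ?thesis using b that by linarith
    qed
    ultimately have k3: "3 * k\<^sup>2 + 5 * k - 73 / 4 < 0" by blast
    have "k < 2"
    proof (rule ccontr)
      assume "\<not> k < 2"
      then have "2 * 2 \<le> k * k" by (intro mult_mono) auto
      then show False using k3 \<open>\<not> k < 2\<close> by (simp add: power2_eq_square)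
    qed
    then have m2: "m\<^sub>2 = Suc m\<^sub>1" using k1 by (simp add: k_def x_def y_def)
    then have y: "y = x + 1" by (simp add: x_def y_def)
    have "?b = 4 * (x * (9 - 2 * x) - 5)" unfolding y by algebra
    then have "x * (9 - 2 * x) > 0" using b by simp
    then have "x < 5" using pos by (simp add: zero_less_mult_iff)
    then have "m\<^sub>1 = 1 \<or> m\<^sub>1 = 2 \<or> m\<^sub>1 = 3 \<or> m\<^sub>1 = 4" using m by (auto simp: x_def)
    \<comment> \<open>For the value 4 \<open>?b\<close> is negative, a contradiction. For 1, 2 and 3
      the discriminant condition reads 64 < 2016, 1600 < 11520 and 2304 < 46656.\<close>
    then show ?thesis using b by (auto simp: x_def y_def m2 power2_eq_square)
  qed
qed

text \<open>The normal component of the \<open>c\<close>-bitension field of an \<open>m\<close>-dimensional hypersurface with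
  constant power sums \<open>s\<^sub>1, s\<^sub>2, s\<^sub>3\<close> of the principal curvatures.\<close>

definition c_bitension_coeff :: "real \<Rightarrow> real \<Rightarrow> real \<Rightarrow> real \<Rightarrow> real" where
  "c_bitension_coeff m s\<^sub>1 s\<^sub>2 s\<^sub>3 = s\<^sub>1 * (m - s\<^sub>2) - 2 / 3 * (m * (m - 1) + s\<^sub>1\<^sup>2 - s\<^sub>2) * s\<^sub>1
     + 2 * ((m - 1) * s\<^sub>1 + s\<^sub>1 * s\<^sub>2 - s\<^sub>3)"

text \<open>Give the power sums the weights 1, 2 and 3. Every term then has odd weight at most 3, up
  to powers of \<open>m\<close>, and a power sum of weight \<open>j\<close> times
  \<open>a ^ j\<close> is a polynomial in \<open>a\<^sup>2\<close>. So \<open>a ^ 3\<close> clears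
  all denominators in \<open>a\<close> and leaves a polynomial in \<open>a\<^sup>2\<close>; the
  factor 3 clears the thirds.\<close>

lemma c_bitension_coeff_degree_4:
  fixes x y a :: real
  assumes "a \<noteq> 0"
  shows "3 * a ^ 3 * c_bitension_coeff (2 * (x + y)) (x * a - y * (4 / a))
       (x * (a\<^sup>2 + 2) + y * ((4 / a)\<^sup>2 + 2)) (x * (a ^ 3 + 3 * a) - y * ((4 / a) ^ 3 + 3 * (4 / a)))
     = - x * (2 * x\<^sup>2 - 5 * x + 6) * (a\<^sup>2) ^ 3
     + x * (32 * x + 12 * y - 24 - 8 * (x\<^sup>2 + y\<^sup>2 - x * y)) * (a\<^sup>2)\<^sup>2
     + y * (32 * (x\<^sup>2 + y\<^sup>2 - x * y) - 48 * x - 128 * y + 96) * a\<^sup>2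
     + 64 * y * (2 * y\<^sup>2 - 5 * y + 6)"
proof -
  define f where "f = x * a - y * (4 / a)"
  define s\<^sub>2 where "s\<^sub>2 = x * (a\<^sup>2 + 2) + y * ((4 / a)\<^sup>2 + 2)"
  define s\<^sub>3 where "s\<^sub>3 = x * (a ^ 3 + 3 * a) - y * ((4 / a) ^ 3 + 3 * (4 / a))"
  define u where "u = a\<^sup>2"
  have f: "a * f = x * u - 4 * y"
    using assms by (simp add: f_def u_def field_simps power2_eq_square)
  have s2: "a\<^sup>2 * s\<^sub>2 = x * (u\<^sup>2 + 2 * u) + y * (16 + 2 * u)"
    using assms by (simp add: s\<^sub>2_def u_def field_simps power2_eq_square)
  have s3: "a ^ 3 * s\<^sub>3 = x * (u ^ 3 + 3 * u\<^sup>2) - y * (64 + 12 * u)"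
    using assms by (simp add: s\<^sub>3_def u_def field_simps power2_eq_square power3_eq_cube)
  have key: "3 * a ^ 3 * c_bitension_coeff m f s\<^sub>2 s\<^sub>3 = 3 * (a * f) * (m * u - a\<^sup>2 * s\<^sub>2)
      - 2 * (m * (m - 1) * u + (a * f)\<^sup>2 - a\<^sup>2 * s\<^sub>2) * (a * f)
      + 6 * ((m - 1) * (a * f) * u + (a * f) * (a\<^sup>2 * s\<^sub>2) - a ^ 3 * s\<^sub>3)" for m
    unfolding c_bitension_coeff_def u_def
    by (simp add: field_simps power2_eq_square power3_eq_cube)
  have "3 * a ^ 3 * c_bitension_coeff (2 * (x + y)) f s\<^sub>2 s\<^sub>3
     = - x * (2 * x\<^sup>2 - 5 * x + 6) * u ^ 3
     + x * (32 * x + 12 * y - 24 - 8 * (x\<^sup>2 + y\<^sup>2 - x * y)) * u\<^sup>2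
     + y * (32 * (x\<^sup>2 + y\<^sup>2 - x * y) - 48 * x - 128 * y + 96) * u
     + 64 * y * (2 * y\<^sup>2 - 5 * y + 6)"
    unfolding key f s2 s3 by algebra
  then show ?thesis unfolding f_def s\<^sub>2_def s\<^sub>3_def u_def .
qed

section \<open>Principal curvatures in degree 4\<close>

lemma cot_add_pi_half: "cot (s + pi / 2) = - tan s" for s :: real
  by (simp add: cot_def tan_def sin_add cos_add)

lemma tan_bounds_quarter:
  assumes "s \<in> {0<..<pi / 4}"
  shows "0 < tan s" "tan s < 1"
  using assms tan_gt_zero[of s] tan_monotone[of s "pi / 4"] tan_45 by auto

lemma cot_add_quarter:
  assumes "s \<in> {0<..<pi / 4}"
  shows "cot (s + pi / 4) = (1 - tan s) / (1 + tan s)"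
proof -
  have "cos s > 0" "sin s > 0" using assms by (auto intro: cos_gt_zero sin_gt_zero)
  moreover have "cot (s + pi / 4) = (cos s - sin s) / (cos s + sin s)"
  proof -
    define r where "r = sqrt 2 / (2::real)"
    have "cot (s + pi / 4) = (r * (cos s - sin s)) / (r * (cos s + sin s))"
      by (simp only: cot_def sin_add cos_add cos_45 sin_45 r_def[symmetric] algebra_simps)
    also have "\<dots> = (cos s - sin s) / (cos s + sin s)"
      by (rule mult_divide_mult_cancel_left) (simp add: r_def)
    finally show ?thesis .
  qed
  moreover have "cos s - sin s = cos s * (1 - tan s)" "cos s + sin s = cos s * (1 + tan s)"
    using \<open>cos s > 0\<close> by (simp_all add: tan_def field_simps)
  ultimately show ?thesis by simp
qed

text \<open>Two numbers with product \<open>- 1\<close> and sum \<open>t\<close> have power sums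
  \<open>t\<close>, \<open>t\<^sup>2 + 2\<close> and \<open>t ^ 3 + 3 * t\<close> by Newton's
  identities; this is applied to the odd and to the even indices.\<close>

lemma cot_power_sums:
  fixes w :: "nat \<Rightarrow> real"
  assumes s: "s \<in> {0<..<pi / 4}"
  defines "a \<equiv> cot s - tan s" and "k \<equiv> \<lambda>i. cot (s + real (i - 1) * pi / real 4)"
  assumes w: "\<And>i. w i = (if odd i then x else y)"
  shows "a > 0"
    "(\<Sum>i\<in>{1..4}. w i * k i) = x * a - y * (4 / a)"
    "(\<Sum>i\<in>{1..4}. w i * (k i)\<^sup>2) = x * (a\<^sup>2 + 2) + y * ((4 / a)\<^sup>2 + 2)"
    "(\<Sum>i\<in>{1..4}. w i * k i ^ 3) = x * (a ^ 3 + 3 * a) - y * ((4 / a) ^ 3 + 3 * (4 / a))"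
proof -
  define q where "q = tan s"
  have q: "0 < q" "q < 1" using tan_bounds_quarter[OF s] by (auto simp: q_def)
  \<comment> \<open>This is \<open>tan (pi / 4 - s)\<close>, so that \<open>1 / r - r\<close> equals
    \<open>2 * tan (2 * s)\<close>, that is \<open>4 / a\<close>.\<close>
  define r where "r = (1 - q) / (1 + q)"
  have r: "r > 0" using q by (simp add: r_def)
  have k1: "k 1 = 1 / q" by (simp add: k_def q_def cot_def tan_def)
  have k2: "k 2 = r" using cot_add_quarter[OF s] by (simp add: k_def r_def q_def)
  have k3: "k 3 = - q" using cot_add_pi_half[of s] by (simp add: k_def q_def)
  have "k 4 = cot ((s + pi / 4) + pi / 2)" by (simp add: k_def add.commute)
  also have "\<dots> = - tan (s + pi / 4)" by (rule cot_add_pi_half)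
  also have "tan (s + pi / 4) = 1 / cot (s + pi / 4)" by (simp add: cot_def tan_def)
  finally have k4: "k 4 = - (1 / r)" using k2 by (simp add: k_def)
  have a: "a = 1 / q - q" using k1 by (simp add: a_def k_def q_def)
  have "q * q < 1 * 1" using q by (intro mult_strict_mono) auto
  then show "a > 0" using q unfolding a by (simp add: field_simps)
  have nz: "q \<noteq> 0" "1 + q \<noteq> 0" "1 - q \<noteq> 0" using q by auto
  have "a = (1 - q) * (1 + q) / q" unfolding a using nz by (simp add: field_simps)
  moreover have "1 / r - r = 4 * q / ((1 - q) * (1 + q))"
    unfolding r_def using nz by (simp add: divide_simps) algebra
  ultimately have b: "4 / a = 1 / r - r" by simp
  have sum4: "(\<Sum>i\<in>{1..4}. w i * F (k i)) = x * (F (1 / q) + F (- q)) + y * (F r + F (- (1 / r)))"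
    for F :: "real \<Rightarrow> real"
  proof -
    have "{1..4} = {1, 2, 3, 4::nat}" by auto
    then show ?thesis by (simp add: w k1 k2 k3 k4 algebra_simps del: One_nat_def)
  qed
  \<comment> \<open>Treating the reciprocals as variables bound by the relations \<open>qr\<close>
    turns the last two sums into polynomial identities.\<close>
  define q' where "q' = 1 / q"
  define r' where "r' = 1 / r"
  have qr: "q * q' = 1" "r * r' = 1" using q r by (auto simp: q'_def r'_def)
  show "(\<Sum>i\<in>{1..4}. w i * k i) = x * a - y * (4 / a)"
    unfolding sum4[of "\<lambda>k. k"] unfolding b unfolding a by (simp add: algebra_simps)
  show "(\<Sum>i\<in>{1..4}. w i * (k i)\<^sup>2) = x * (a\<^sup>2 + 2) + y * ((4 / a)\<^sup>2 + 2)"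
    unfolding sum4[of "\<lambda>k. k\<^sup>2"] unfolding b unfolding a q'_def[symmetric] r'_def[symmetric] using qr by algebra
  show "(\<Sum>i\<in>{1..4}. w i * k i ^ 3) = x * (a ^ 3 + 3 * a) - y * ((4 / a) ^ 3 + 3 * (4 / a))"
    unfolding sum4[of "\<lambda>k. k ^ 3"] unfolding b unfolding a q'_def[symmetric] r'_def[symmetric] using qr by algebra
qed

text \<open>The left side is \<open>2 / tan (2 * s)\<close>, and \<open>2 * s\<close> lies in the
  principal branch of \<open>arctan\<close>; hence the inverse is
  \<open>arctan (2 / a) / 2\<close>.\<close>

lemma cot_minus_tan_bij:
  fixes a :: real
  assumes "a > 0"
  shows "\<exists>!s. s \<in> {0<..<pi / 4} \<and> cot s - tan s = a"
proof -
  have eq: "cot s - tan s = 2 / tan (2 * s)" if "s \<in> {0<..<pi / 4}" for s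
  proof -
    have "cos s > 0" "sin s > 0" using that by (auto intro: cos_gt_zero sin_gt_zero)
    moreover have "tan s = sin s / cos s" "cot s = cos s / sin s" by (simp_all add: tan_def cot_def)
    moreover have "tan (2 * s) = (2 * sin s * cos s) / ((cos s)\<^sup>2 - (sin s)\<^sup>2)"
      by (simp only: tan_def sin_double cos_double)
    moreover have "cos s / sin s - sin s / cos s = ((cos s)\<^sup>2 - (sin s)\<^sup>2) / (sin s * cos s)"
      using \<open>cos s > 0\<close> \<open>sin s > 0\<close> by (simp add: field_simps power2_eq_square)
    moreover have "2 / (2 * S * C / D) = D / (S * C)" for S C D :: real by (simp add: mult.assoc)
    ultimately show ?thesis by (simp only:)
  qed
  have iff: "cot s - tan s = a \<longleftrightarrow> s = arctan (2 / a) / 2" if s: "s \<in> {0<..<pi / 4}" for s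
  proof -
    have "tan (2 * s) > 0" using s by (intro tan_gt_zero) auto
    then have "cot s - tan s = a \<longleftrightarrow> tan (2 * s) = 2 / a"
      unfolding eq[OF s] using assms by (auto simp: field_simps)
    also have "\<dots> \<longleftrightarrow> 2 * s = arctan (2 / a)"
    proof
      assume "tan (2 * s) = 2 / a"
      then show "2 * s = arctan (2 / a)" using s by (intro arctan_unique[symmetric]) auto
    qed (simp add: tan_arctan)
    finally show ?thesis by auto
  qed
  have "arctan (2 / a) / 2 \<in> {0<..<pi / 4}"
    using assms arctan_ubound[of "2 / a"] by simp
  then show ?thesis using iff by blast
qed

text \<open>Squaring is a bijection of the positive reals and \<open>3 * a ^ 3\<close> does not
  vanish there, so positive zeros correspond to positive roots of the cubic.\<close>

lemma ex1_c_bitension_coeff_eq_0: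
  fixes m\<^sub>1 m\<^sub>2 :: nat
  defines "x \<equiv> real m\<^sub>1" and "y \<equiv> real m\<^sub>2"
  assumes m: "0 < m\<^sub>1" "m\<^sub>1 < m\<^sub>2"
  shows "\<exists>!a. a > 0 \<and> c_bitension_coeff (2 * (x + y)) (x * a - y * (4 / a))
       (x * (a\<^sup>2 + 2) + y * ((4 / a)\<^sup>2 + 2))
       (x * (a ^ 3 + 3 * a) - y * ((4 / a) ^ 3 + 3 * (4 / a))) = 0"
    (is "\<exists>!a. a > 0 \<and> ?C a = 0")
proof -
  define P where "P = (\<lambda>u. - x * (2 * x\<^sup>2 - 5 * x + 6) * u ^ 3
     + x * (32 * x + 12 * y - 24 - 8 * (x\<^sup>2 + y\<^sup>2 - x * y)) * u\<^sup>2
     + y * (32 * (x\<^sup>2 + y\<^sup>2 - x * y) - 48 * x - 128 * y + 96) * u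
     + 64 * y * (2 * y\<^sup>2 - 5 * y + 6))"
  have C: "?C a = 0 \<longleftrightarrow> P (a\<^sup>2) = 0" if "a > 0" for a
  proof -
    have P: "P (a\<^sup>2) = 3 * a ^ 3 * ?C a"
      unfolding P_def by (rule c_bitension_coeff_degree_4[symmetric]) (use that in simp)
    have "3 * a ^ 3 * r = 0 \<longleftrightarrow> r = 0" for r using that by simp
    then show ?thesis unfolding P by (rule sym)
  qed
  have "\<exists>!u. u > 0 \<and> P u = 0"
    unfolding P_def x_def y_def by (rule multiplicity_cubic_unique_pos_root[OF m])
  then obtain u where u: "u > 0 \<and> P u = 0" "\<forall>v. v > 0 \<and> P v = 0 \<longrightarrow> v = u"
    by (rule ex1E)
  show ?thesis
  proof (rule ex1I)
    have "sqrt u > 0" "P ((sqrt u)\<^sup>2) = 0" using u(1) by simp_all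
    then show "sqrt u > 0 \<and> ?C (sqrt u) = 0" by (intro conjI C[THEN iffD2])
    fix a assume a: "a > 0 \<and> ?C a = 0"
    have "P (a\<^sup>2) = 0" by (rule C[THEN iffD1]) (use a in \<open>rule conjunct1, rule conjunct2\<close>)
    then have "a\<^sup>2 = u" using u(2) conjunct1[OF a] by simp
    then show "a = sqrt u" using real_sqrt_unique[of a u] conjunct1[OF a] by simp
  qed
qed

lemma c_bitension_coeff_not_minimal:
  fixes x y a :: real
  assumes "0 < x" "x < y" "a > 0" "x * a - y * (4 / a) = 0"
  shows "c_bitension_coeff m (x * a - y * (4 / a)) s
     (x * (a ^ 3 + 3 * a) - y * ((4 / a) ^ 3 + 3 * (4 / a))) \<noteq> 0"
proof -
  define b where "b = 4 / a"
  have b: "b > 0" "a * b = 4" using assms by (auto simp: b_def)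
  have xa: "x * a = y * b" using assms by (simp add: b_def)
  have "x * b < y * b" using assms b by simp
  then have "x * b < x * a" using xa by simp
  then have "b < a" using assms(1) by simp
  \<comment> \<open>Substituting \<open>x * a = y * b\<close> cancels the linear terms and leaves a
    difference of squares; \<open>x < y\<close> enters through \<open>b < a\<close>.\<close>
  have "x * (a ^ 3 + 3 * a) - y * (b ^ 3 + 3 * b) = (x * a) * ((a - b) * (a + b))"
    using xa by algebra
  also have "\<dots> > 0" using assms b \<open>b < a\<close> by simp
  finally have "x * (a ^ 3 + 3 * a) - y * ((4 / a) ^ 3 + 3 * (4 / a)) \<noteq> 0"
    unfolding b_def by simp
  moreover have "c_bitension_coeff m 0 s t = - 2 * t" for t by (simp add: c_bitension_coeff_def)
  ultimately show ?thesis unfolding assms(4) by simp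
qed

section \<open>Hypersurfaces in a chart\<close>

text \<open>A single chart, with \<open>f\<close> and \<open>n\<close> the coordinate expressions of
  the immersion and of the normal. Unit length and orthogonality are written as inner products on
  \<open>U\<close>, the form in which they are differentiated.\<close>

locale hypersurface_patch =
  fixes U :: "(real^'m::finite) set" and f n :: "real^'m \<Rightarrow> 'e::euclidean_space"
  assumes open_U: "open U" and DIM_eq: "DIM('e) = CARD('m) + 2"
    and smooth_f: "smooth_on U f" and smooth_n: "smooth_on U n"
    and f_f: "u \<in> U \<Longrightarrow> f u \<bullet> f u = 1" and n_n: "u \<in> U \<Longrightarrow> n u \<bullet> n u = 1"
    and n_f: "u \<in> U \<Longrightarrow> n u \<bullet> f u = 0"
    and inj_df: "u \<in> U \<Longrightarrow> inj (\<lambda>v. dd v f u)"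
    and n_df: "u \<in> U \<Longrightarrow> n u \<bullet> dd v f u = 0"
begin

abbreviation ip :: "real^'m \<Rightarrow> real^'m \<Rightarrow> real^'m \<Rightarrow> real" where
  "ip u v w \<equiv> dd v f u \<bullet> dd w f u"

abbreviation A :: "real^'m \<Rightarrow> real^'m \<Rightarrow> real^'m" where
  "A \<equiv> shape_op f n"

definition g :: "'m metric" where
  "g u = (\<chi> i j. pderiv_dir i f u \<bullet> pderiv_dir j f u)"

text \<open>The difference between the Levi-Civita connection and the flat derivative, as a bilinear
  map on vectors.\<close>

definition \<Gamma> :: "real^'m \<Rightarrow> real^'m \<Rightarrow> real^'m \<Rightarrow> real^'m" where
  "\<Gamma> u v w = (\<chi> k. \<Sum>i\<in>UNIV. \<Sum>j\<in>UNIV. christoffel g u k i j * v $ i * w $ j)"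

section \<open>Orthogonality relations of the frame\<close>

lemma smooth_df: "smooth_on U (dd v f)" and smooth_ddf: "smooth_on U (dd w (dd v f))"
  and smooth_dn: "smooth_on U (dd v n)"
  by (intro smooth_on_dd open_U smooth_f smooth_n)+

lemmas diff_f = smooth_on_imp_differentiable[OF smooth_f]
  and diff_n = smooth_on_imp_differentiable[OF smooth_n]
  and diff_df = smooth_on_imp_differentiable[OF smooth_df]
  and diff_dn = smooth_on_imp_differentiable[OF smooth_dn]
  and diff_ddf = smooth_on_imp_differentiable[OF smooth_ddf]

lemmas linear_df = linear_dd[OF diff_f]

text \<open>The relations of the frame arise from this by differentiating inner products that are
  constant on \<open>U\<close>.\<close>

lemma dd_inner_cong:
  assumes "u \<in> U" "\<And>y. y \<in> U \<Longrightarrow> F y \<bullet> G y = r y"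
    and "F differentiable (at u)" "G differentiable (at u)"
  shows "F u \<bullet> dd v G u + dd v F u \<bullet> G u = dd v r u"
proof -
  have "dd v (\<lambda>y. F y \<bullet> G y) u = dd v r u" by (rule dd_cong_open[OF open_U assms(1,2)])
  then show ?thesis by (simp add: dd_inner[OF assms(3,4)])
qed

lemma f_df:
  assumes u: "u \<in> U" shows "f u \<bullet> dd v f u = 0"
  using dd_inner_cong[OF u, of f f "\<lambda>_. 1" v] f_f diff_f[OF u] by (simp add: dd_const inner_commute)

lemma n_dn:
  assumes u: "u \<in> U" shows "n u \<bullet> dd v n u = 0"
  using dd_inner_cong[OF u, of n n "\<lambda>_. 1" v] n_n diff_n[OF u] by (simp add: dd_const inner_commute)

lemma dn_f:
  assumes u: "u \<in> U" shows "dd v n u \<bullet> f u = 0"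
  using dd_inner_cong[OF u, of n f "\<lambda>_. 0" v] n_f n_df diff_n[OF u] diff_f[OF u] u
  by (simp add: dd_const)

lemma f_ddf:
  assumes u: "u \<in> U" shows "f u \<bullet> dd v (dd w f) u = - ip u v w"
  using dd_inner_cong[OF u, of f "dd w f" "\<lambda>_. 0" v] f_df diff_f[OF u] diff_df[OF u] u
  by (simp add: dd_const)

lemma n_ddf:
  assumes u: "u \<in> U" shows "n u \<bullet> dd v (dd w f) u = - (dd v n u \<bullet> dd w f u)"
  using dd_inner_cong[OF u, of n "dd w f" "\<lambda>_. 0" v] n_df diff_n[OF u] diff_df[OF u] u
  by (simp add: dd_const)

lemma n_ddn:
  assumes u: "u \<in> U" shows "n u \<bullet> dd v (dd w n) u = - (dd v n u \<bullet> dd w n u)"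
  using dd_inner_cong[OF u, of n "dd w n" "\<lambda>_. 0" v] n_dn diff_n[OF u] diff_dn[OF u] u
  by (simp add: dd_const)

lemma frame:
  assumes "u \<in> U"
  shows "f u \<bullet> f u = 1" "n u \<bullet> n u = 1" "n u \<bullet> f u = 0" "f u \<bullet> n u = 0"
    "f u \<bullet> dd v f u = 0" "dd v f u \<bullet> f u = 0" "n u \<bullet> dd v f u = 0" "dd v f u \<bullet> n u = 0"
    "n u \<bullet> dd v n u = 0" "dd v n u \<bullet> n u = 0" "f u \<bullet> dd v n u = 0" "dd v n u \<bullet> f u = 0"
    "dd v (dd w f) u \<bullet> f u = - ip u v w" "dd v (dd w f) u \<bullet> n u = - (dd v n u \<bullet> dd w f u)"
    "dd v (dd w n) u \<bullet> n u = - (dd v n u \<bullet> dd w n u)"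
  using f_f n_n n_f f_df n_df n_dn dn_f f_ddf n_ddf n_ddn assms by (simp_all add: inner_commute)

lemma ddf_commute: "u \<in> U \<Longrightarrow> dd v (dd w f) u = dd w (dd v f) u"
  by (rule dd_commute[OF open_U _ smooth_f])

lemma dn_df_commute:
  assumes u: "u \<in> U" shows "dd v n u \<bullet> dd w f u = dd w n u \<bullet> dd v f u"
  using n_ddf[OF u, of v w] n_ddf[OF u, of w v] ddf_commute[OF u, of v w] by simp

text \<open>A dimension count: injectivity gives the image of the differential dimension
  \<open>CARD('m)\<close>, and the two further orthogonal directions exhaust the ambient
  space.\<close>

lemma tangent_expansion:
  assumes u: "u \<in> U"
  obtains v k l where "x = dd v f u + l *\<^sub>R f u + k *\<^sub>R n u"
proof -
  let ?T = "range (\<lambda>v. dd v f u)"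
  have "subspace ?T" by (intro linear_subspace_image linear_df[OF u] subspace_UNIV)
  then have sT: "span ?T = ?T" by (simp add: span_eq_iff)
  have dT: "dim ?T = CARD('m)"
    using dim_image_eq[OF linear_df[OF u], of UNIV] inj_df[OF u] by simp
  have fT: "f u \<notin> span ?T"
  proof
    assume "f u \<in> span ?T"
    then obtain v where "f u = dd v f u" unfolding sT by auto
    then show False using f_df[OF u, of v] f_f[OF u] by simp
  qed
  have nT: "n u \<notin> span (insert (f u) ?T)"
  proof
    assume "n u \<in> span (insert (f u) ?T)"
    then obtain k where "n u - k *\<^sub>R f u \<in> span ?T" using span_breakdown_eq by blast
    then obtain v where "n u - k *\<^sub>R f u = dd v f u" unfolding sT by auto
    then have "n u \<bullet> (n u - k *\<^sub>R f u) = 0" using n_df[OF u] by simp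
    then show False using n_n[OF u] n_f[OF u] by (simp add: inner_diff_right)
  qed
  have "dim (insert (n u) (insert (f u) ?T)) = DIM('e)"
    using fT nT dT by (simp add: dim_insert DIM_eq)
  then have "span (insert (n u) (insert (f u) ?T)) = UNIV" by (simp add: dim_eq_full)
  then have "x \<in> span (insert (n u) (insert (f u) ?T))" by simp
  then obtain k where "x - k *\<^sub>R n u \<in> span (insert (f u) ?T)" using span_breakdown_eq by blast
  then obtain l where "x - k *\<^sub>R n u - l *\<^sub>R f u \<in> span ?T" using span_breakdown_eq by blast
  then obtain v where "x - k *\<^sub>R n u - l *\<^sub>R f u = dd v f u" unfolding sT by auto
  then have "x = dd v f u + l *\<^sub>R f u + k *\<^sub>R n u" by (simp add: algebra_simps)
  then show thesis by (rule that)
qed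

text \<open>The difference is orthogonal to a spanning set, hence to itself.\<close>

lemma frame_eqI:
  assumes u: "u \<in> U" and "x \<bullet> f u = y \<bullet> f u" "x \<bullet> n u = y \<bullet> n u" "\<And>v. x \<bullet> dd v f u = y \<bullet> dd v f u"
  shows "x = y"
proof -
  obtain v k l where "x - y = dd v f u + l *\<^sub>R f u + k *\<^sub>R n u" using tangent_expansion[OF u] .
  then have "(x - y) \<bullet> (x - y) = (x - y) \<bullet> (dd v f u + l *\<^sub>R f u + k *\<^sub>R n u)" by simp
  also have "\<dots> = 0" using assms(2-4) by (simp add: inner_add_right inner_diff_left)
  finally show ?thesis by simp
qed

lemma ip_eqI:
  assumes u: "u \<in> U" and "\<And>z. ip u v z = ip u w z"
  shows "v = w"
proof -
  have "dd v f u = dd w f u"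
    by (rule frame_eqI[OF u]) (simp_all add: frame[OF u] assms)
  then show ?thesis using inj_df[OF u] by (simp add: inj_def)
qed

lemma inner_df_eqI:
  assumes u: "u \<in> U" and "\<And>l. x \<bullet> pderiv_dir l f u = y \<bullet> pderiv_dir l f u"
  shows "x \<bullet> dd z f u = y \<bullet> dd z f u"
  by (simp add: dd_eq_sum_pderiv_dir[OF diff_f[OF u]] inner_sum_right assms)

lemma g_mult:
  assumes u: "u \<in> U" shows "(g u *v v) $ j = dd v f u \<bullet> pderiv_dir j f u"
  unfolding dd_eq_sum_pderiv_dir[OF diff_f[OF u], of v]
  by (subst inner_commute) (simp add: inner_sum_right g_def matrix_vector_mult_def mult.commute)

lemma transpose_g: "transpose (g u) = g u"
  by (simp add: transpose_def g_def vec_eq_iff inner_commute)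

lemma invertible_g:
  assumes u: "u \<in> U" shows "invertible (g u)"
  unfolding invertible_left_inverse matrix_left_invertible_ker
proof (intro allI impI)
  fix v assume "g u *v v = 0"
  then have "dd v f u \<bullet> pderiv_dir j f u = 0 \<bullet> pderiv_dir j f u" for j
    using g_mult[OF u, of v j] by simp
  then have "ip u v z = 0 \<bullet> dd z f u" for z by (rule inner_df_eqI[OF u])
  then show "v = 0" using ip_eqI[OF u, of v 0] linear_0[OF linear_df[OF u]] by simp
qed

text \<open>The tension field, the components of the rough Laplacian, the curvature term and the
  Ricci term are all evaluated in this form.\<close>

lemma metric_trace_ip:
  assumes u: "u \<in> U" and b: "\<And>v w. b v w = ip u (L v) w *\<^sub>R c"
  shows "metric_trace g u b = trace (matrix L) *\<^sub>R c"
  by (rule metric_trace_eq_trace[of g u, OF invertible_g[OF u] transpose_g]) (simp add: b g_mult[OF u] pderiv_dir_eq_dd)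

section \<open>The shape operator\<close>

lemma df_shape_op:
  assumes u: "u \<in> U" shows "dd (A u v) f u = - dd v n u"
proof -
  have "pullback_conn f (\<lambda>_. v) n u = dd v n u"
    by (simp add: pullback_conn_def sphere_proj_def dn_f[OF u] flip: dd_def)
  then have A: "A u v = (THE w. dd w f u = - dd v n u)"
    by (simp add: shape_op_def dd_def)
  \<comment> \<open>The derivative of \<open>n\<close> is orthogonal to \<open>f u\<close> and
    \<open>n u\<close>, hence tangential; with injectivity of the differential this makes the
    description in \<open>shape_op\<close> proper.\<close>
  obtain w k l where w: "- dd v n u = dd w f u + l *\<^sub>R f u + k *\<^sub>R n u"
    using tangent_expansion[OF u] .
  have "l = 0" using arg_cong[OF w, of "\<lambda>x. x \<bullet> f u"] by (simp add: inner_add_left frame[OF u])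
  moreover have "k = 0" using arg_cong[OF w, of "\<lambda>x. x \<bullet> n u"] by (simp add: inner_add_left frame[OF u])
  ultimately have "dd w f u = - dd v n u" using w by simp
  then show ?thesis
    unfolding A by (rule theI) (rule injD[OF inj_df[OF u]], simp add: \<open>dd w f u = - dd v n u\<close>)
qed

lemma dn_eq: "u \<in> U \<Longrightarrow> dd v n u = - dd (A u v) f u"
  using df_shape_op by simp

lemma linear_shape_op:
  assumes u: "u \<in> U" shows "linear (A u)"
proof (rule linearI)
  show "A u (v + w) = A u v + A u w" for v w
    by (rule injD[OF inj_df[OF u]])
      (simp add: df_shape_op[OF u] dd_add_dir diff_f[OF u] diff_n[OF u])
  show "A u (c *\<^sub>R v) = c *\<^sub>R A u v" for c v
    by (rule injD[OF inj_df[OF u]])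
      (simp add: df_shape_op[OF u] dd_scaleR_dir diff_f[OF u] diff_n[OF u])
qed

lemma shape_op_self_adjoint:
  assumes u: "u \<in> U" shows "ip u (A u v) w = ip u v (A u w)"
  using dn_df_commute[OF u, of v w] by (simp add: df_shape_op[OF u] inner_commute)

lemma n_ddf_shape_op: "u \<in> U \<Longrightarrow> n u \<bullet> dd v (dd w f) u = ip u (A u v) w"
  by (simp only: n_ddf df_shape_op inner_minus_left)

section \<open>Christoffel symbols and the Gauss formula\<close>

lemma ddf_expansion:
  assumes u: "u \<in> U"
  shows "dd v (dd w f) u = (\<Sum>i\<in>UNIV. \<Sum>j\<in>UNIV. (v $ i * w $ j) *\<^sub>R pderiv_dir i (pderiv_dir j f) u)"
proof -
  have "dd v (dd w f) u = (\<Sum>i\<in>UNIV. v $ i *\<^sub>R dd (axis i 1) (dd w f) u)"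
    by (rule linear_eq_sum_axis[OF linear_dd[OF diff_df[OF u]]])
  also have "\<dots> = (\<Sum>i\<in>UNIV. v $ i *\<^sub>R (\<Sum>j\<in>UNIV. w $ j *\<^sub>R dd (axis i 1) (dd (axis j 1) f) u))"
  proof (rule sum.cong[OF refl])
    fix i
    \<comment> \<open>Swapping the derivatives makes \<open>w\<close> the outer direction, in which
      linearity is available.\<close>
    have "dd (axis i 1) (dd w f) u = dd w (dd (axis i 1) f) u" by (rule ddf_commute[OF u])
    also have "\<dots> = (\<Sum>j\<in>UNIV. w $ j *\<^sub>R dd (axis j 1) (dd (axis i 1) f) u)"
      by (rule linear_eq_sum_axis[OF linear_dd[OF diff_df[OF u]]])
    finally show "v $ i *\<^sub>R dd (axis i 1) (dd w f) u
        = v $ i *\<^sub>R (\<Sum>j\<in>UNIV. w $ j *\<^sub>R dd (axis i 1) (dd (axis j 1) f) u)"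
      by (simp only: ddf_commute[OF u, of _ "axis i 1"])
  qed
  finally show ?thesis by (simp only: pderiv_dir_eq_dd scaleR_sum_right scaleR_scaleR)
qed

text \<open>The product rule gives six terms; as second derivatives commute, four of them cancel and
  the other two coincide.\<close>

lemma christoffel_eq:
  assumes u: "u \<in> U"
  shows "christoffel g u k i j =
    (\<Sum>l\<in>UNIV. matrix_inv (g u) $ k $ l * (pderiv_dir i (pderiv_dir j f) u \<bullet> pderiv_dir l f u))"
proof -
  have dg: "pderiv_dir l (\<lambda>w. g w $ i $ j) u =
      pderiv_dir i f u \<bullet> pderiv_dir l (pderiv_dir j f) u
      + pderiv_dir l (pderiv_dir i f) u \<bullet> pderiv_dir j f u" for i j l
    unfolding g_def pderiv_dir_eq_dd using dd_inner[OF diff_df[OF u] diff_df[OF u]] by simp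
  have "pderiv_dir i (\<lambda>w. g w $ j $ l) u + pderiv_dir j (\<lambda>w. g w $ i $ l) u
      - pderiv_dir l (\<lambda>w. g w $ i $ j) u = 2 * (pderiv_dir i (pderiv_dir j f) u \<bullet> pderiv_dir l f u)" for l
    unfolding dg unfolding pderiv_dir_eq_dd
    using ddf_commute[OF u, of "axis i 1" "axis l 1"] ddf_commute[OF u, of "axis j 1" "axis l 1"]
      ddf_commute[OF u, of "axis i 1" "axis j 1"]
    by (simp add: inner_commute)
  then show ?thesis by (simp add: christoffel_def sum_distrib_left)
qed

text \<open>Stated as a linear system, the shape that \<open>differentiable_linear_solution\<close>
  requires.\<close>

lemma g_mult_\<Gamma>:
  assumes u: "u \<in> U"
  shows "g u *v \<Gamma> u v w = (\<chi> l. dd v (dd w f) u \<bullet> pderiv_dir l f u)"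
proof -
  have "\<Gamma> u v w = matrix_inv (g u) *v (\<chi> l. dd v (dd w f) u \<bullet> pderiv_dir l f u)"
  proof -
    have "\<Gamma> u v w $ k = (matrix_inv (g u) *v (\<chi> l. dd v (dd w f) u \<bullet> pderiv_dir l f u)) $ k" for k
    proof -
      have "\<Gamma> u v w $ k = (\<Sum>i\<in>UNIV. \<Sum>j\<in>UNIV. \<Sum>l\<in>UNIV. matrix_inv (g u) $ k $ l *
          ((v $ i * w $ j) * (pderiv_dir i (pderiv_dir j f) u \<bullet> pderiv_dir l f u)))"
        by (simp add: \<Gamma>_def christoffel_eq[OF u] sum_distrib_left sum_distrib_right mult_ac)
      also have "\<dots> = (\<Sum>i\<in>UNIV. \<Sum>l\<in>UNIV. \<Sum>j\<in>UNIV. matrix_inv (g u) $ k $ l *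
          ((v $ i * w $ j) * (pderiv_dir i (pderiv_dir j f) u \<bullet> pderiv_dir l f u)))"
        by (rule sum.cong[OF refl], rule sum.swap)
      also have "\<dots> = (\<Sum>l\<in>UNIV. \<Sum>i\<in>UNIV. \<Sum>j\<in>UNIV. matrix_inv (g u) $ k $ l *
          ((v $ i * w $ j) * (pderiv_dir i (pderiv_dir j f) u \<bullet> pderiv_dir l f u)))"
        by (rule sum.swap)
      also have "\<dots> = (\<Sum>l\<in>UNIV. matrix_inv (g u) $ k $ l * (dd v (dd w f) u \<bullet> pderiv_dir l f u))"
        by (simp add: ddf_expansion[OF u] inner_sum_left sum_distrib_left)
      finally show ?thesis by (simp add: matrix_vector_mult_def)
    qed
    then show ?thesis by (simp add: vec_eq_iff)
  qed
  then show ?thesis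
    by (simp add: matrix_vector_mul_assoc matrix_inv_cancel invertible_g[OF u])
qed

lemma ip_\<Gamma>:
  assumes u: "u \<in> U" shows "ip u (\<Gamma> u v w) z = dd v (dd w f) u \<bullet> dd z f u"
  by (rule inner_df_eqI[OF u]) (simp add: g_mult[OF u, symmetric] g_mult_\<Gamma>[OF u])

lemma \<Gamma>_commute:
  assumes u: "u \<in> U" shows "\<Gamma> u v w = \<Gamma> u w v"
  by (rule ip_eqI[OF u]) (simp only: ip_\<Gamma>[OF u] ddf_commute[OF u, of v w])

lemma linear_\<Gamma>: "linear (\<Gamma> u v)"
  by (rule linearI) (simp_all add: \<Gamma>_def vec_eq_iff sum.distrib sum_distrib_left algebra_simps)

lemma \<Gamma>_0: "\<Gamma> u 0 w = 0"
  by (simp add: \<Gamma>_def vec_eq_iff)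

text \<open>The tangential component is \<open>ip_\<Gamma>\<close>; the other two come from
  differentiating the orthogonality of \<open>n\<close> and of \<open>f\<close> to the image of the
  differential. The \<open>f\<close> component is the second fundamental form of the sphere in the
  ambient space.\<close>

lemma gauss_formula:
  assumes u: "u \<in> U"
  shows "dd v (dd w f) u = dd (\<Gamma> u v w) f u + ip u (A u v) w *\<^sub>R n u - ip u v w *\<^sub>R f u"
proof (rule frame_eqI[OF u])
  show "dd v (dd w f) u \<bullet> f u = (dd (\<Gamma> u v w) f u + ip u (A u v) w *\<^sub>R n u - ip u v w *\<^sub>R f u) \<bullet> f u"
    by (simp add: inner_add_left inner_diff_left frame[OF u])
  show "dd v (dd w f) u \<bullet> n u = (dd (\<Gamma> u v w) f u + ip u (A u v) w *\<^sub>R n u - ip u v w *\<^sub>R f u) \<bullet> n u"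
    by (simp add: inner_add_left inner_diff_left frame[OF u] df_shape_op[OF u])
  show "dd v (dd w f) u \<bullet> dd z f u
      = (dd (\<Gamma> u v w) f u + ip u (A u v) w *\<^sub>R n u - ip u v w *\<^sub>R f u) \<bullet> dd z f u" for z
    by (simp add: inner_add_left inner_diff_left ip_\<Gamma>[OF u] frame[OF u])
qed

lemma differentiable_g: "u \<in> U \<Longrightarrow> (\<lambda>y. g y $ i $ j) differentiable (at u)"
  by (simp add: g_def pderiv_dir_eq_dd diff_df)

lemma differentiable_\<Gamma>:
  assumes u: "u \<in> U" shows "(\<lambda>y. \<Gamma> y v w) differentiable (at u)"
  by (rule differentiable_linear_solution[OF open_U u differentiable_g[OF u] _ invertible_g g_mult_\<Gamma>])
    (simp_all add: pderiv_dir_eq_dd diff_df diff_ddf u)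

text \<open>The description in \<open>shape_op\<close> carries no regularity. The linear system
  solved by \<open>A y v\<close> does: its coefficients are inner products of derivatives of
  \<open>f\<close> and \<open>n\<close>.\<close>

lemma differentiable_shape_op:
  assumes u: "u \<in> U" shows "(\<lambda>y. A y v) differentiable (at u)"
proof (rule differentiable_linear_solution[OF open_U u differentiable_g[OF u] _ invertible_g])
  show "g y *v A y v = (\<chi> l. - dd v n y \<bullet> dd (axis l 1) f y)" if "y \<in> U" for y
    by (simp add: vec_eq_iff g_mult[OF that] df_shape_op[OF that] pderiv_dir_eq_dd)
  show "(\<lambda>y. (\<chi> l. - dd v n y \<bullet> dd (axis l 1) f y) $ i) differentiable (at u)" for i
    by (simp add: diff_df diff_dn u)
qed

lemma dd_df_field:
  assumes u: "u \<in> U" and X: "X differentiable (at u)"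
  shows "dd z (\<lambda>y. dd (X y) f y) u = dd (dd z X u) f u + dd z (dd (X u) f) u"
proof -
  have Xi: "(\<lambda>y. X y $ i) differentiable (at u)" for i
    by (rule differentiable_vec_nth[OF X])
  have dXi: "dd z (\<lambda>y. X y $ i) u = dd z X u $ i" for i
    by (rule dd_apply_bounded_linear[OF bounded_linear_vec_nth X])
  have "dd z (\<lambda>y. dd (X y) f y) u = dd z (\<lambda>y. \<Sum>i\<in>UNIV. X y $ i *\<^sub>R dd (axis i 1) f y) u"
    by (rule dd_cong_open[OF open_U u]) (simp add: dd_eq_sum_pderiv_dir[OF diff_f] pderiv_dir_eq_dd)
  also have "\<dots> = (\<Sum>i\<in>UNIV. dd z (\<lambda>y. X y $ i *\<^sub>R dd (axis i 1) f y) u)"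
    by (rule dd_sum) (intro differentiable_scaleR Xi diff_df u)
  also have "\<dots> = (\<Sum>i\<in>UNIV. dd z X u $ i *\<^sub>R dd (axis i 1) f u)
      + (\<Sum>i\<in>UNIV. X u $ i *\<^sub>R dd z (dd (axis i 1) f) u)"
    by (simp only: dd_scaleR[OF Xi diff_df[OF u]] dXi sum.distrib)
  also have "(\<Sum>i\<in>UNIV. dd z X u $ i *\<^sub>R dd (axis i 1) f u) = dd (dd z X u) f u"
    by (rule linear_eq_sum_axis[OF linear_df[OF u], symmetric])
  also have "(\<Sum>i\<in>UNIV. X u $ i *\<^sub>R dd z (dd (axis i 1) f) u) = dd z (dd (X u) f) u"
    unfolding ddf_commute[OF u, of z]
    by (rule linear_eq_sum_axis[OF linear_dd[OF diff_df[OF u]], symmetric])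
  finally show ?thesis .
qed

section \<open>The Gauss equation and the Ricci curvature\<close>

lemma levi_civita_eq: "levi_civita g X Y u = dd (X u) Y u + \<Gamma> u (X u) (Y u)"
  by (simp add: levi_civita_def \<Gamma>_def dd_def)

lemma levi_civita_const: "levi_civita g (\<lambda>_. v) (\<lambda>_. w) = (\<lambda>u. \<Gamma> u v w)"
  by (rule ext) (simp add: levi_civita_eq dd_const)

text \<open>The left side tests the second covariant derivative of constant fields against
  \<open>q\<close>. Differentiating the Gauss formula, the derivatives of its scalar coefficients
  multiply \<open>n\<close> or \<open>f\<close> and are invisible to tangent vectors, while the
  derivatives of \<open>n\<close> and \<open>f\<close> themselves produce the two products.\<close>

lemma ip_second_derivative:
  assumes u: "u \<in> U"
  shows "ip u (dd z (\<lambda>y. \<Gamma> y v w) u + \<Gamma> u z (\<Gamma> u v w)) q =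
    dd z (dd v (dd w f)) u \<bullet> dd q f u + ip u (A u v) w * ip u (A u z) q + ip u v w * ip u z q"
proof -
  \<comment> \<open>On \<open>U\<close> this is \<open>ip y (A y v) w\<close>; written with
    \<open>n\<close>, its differentiability is that of \<open>n\<close> and of second derivatives of
    \<open>f\<close>.\<close>
  let ?h = "\<lambda>y. n y \<bullet> dd v (dd w f) y"
  have eq: "dd (\<Gamma> y v w) f y = dd v (dd w f) y - ?h y *\<^sub>R n y + ip y v w *\<^sub>R f y" if "y \<in> U" for y
    using gauss_formula[OF that, of v w] n_ddf_shape_op[OF that, of v w] by simp
  have dif: "(\<lambda>y. dd (\<Gamma> y v w) f y) differentiable (at u)"
    by (rule differentiable_cong_open[OF open_U u eq, THEN iffD2], assumption)
      (use u in \<open>intro differentiable_add differentiable_diff differentiable_scaleR differentiable_inner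
          diff_ddf diff_n diff_df diff_f\<close>)
  have difh: "?h differentiable (at u)" "(\<lambda>y. ip y v w) differentiable (at u)"
    using u by (auto intro!: differentiable_inner diff_ddf diff_n diff_df)
  have "dd z (dd v (dd w f)) u
      = dd z (\<lambda>y. (dd (\<Gamma> y v w) f y + ?h y *\<^sub>R n y) - ip y v w *\<^sub>R f y) u"
    by (rule dd_cong_open[OF open_U u]) (simp add: eq)
  also have "\<dots> = dd z (\<lambda>y. dd (\<Gamma> y v w) f y + ?h y *\<^sub>R n y) u - dd z (\<lambda>y. ip y v w *\<^sub>R f y) u"
    by (rule dd_diff) (intro differentiable_add dif differentiable_scaleR difh diff_n diff_f u)+
  also have "dd z (\<lambda>y. dd (\<Gamma> y v w) f y + ?h y *\<^sub>R n y) u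
      = dd z (\<lambda>y. dd (\<Gamma> y v w) f y) u + dd z (\<lambda>y. ?h y *\<^sub>R n y) u"
    by (rule dd_add) (intro dif differentiable_scaleR difh diff_n u)+
  also have "dd z (\<lambda>y. ?h y *\<^sub>R n y) u = dd z ?h u *\<^sub>R n u + ?h u *\<^sub>R dd z n u"
    by (rule dd_scaleR[OF difh(1) diff_n[OF u]])
  also have "dd z (\<lambda>y. ip y v w *\<^sub>R f y) u = dd z (\<lambda>y. ip y v w) u *\<^sub>R f u + ip u v w *\<^sub>R dd z f u"
    by (rule dd_scaleR[OF difh(2) diff_f[OF u]])
  also have "dd z (\<lambda>y. dd (\<Gamma> y v w) f y) u
      = dd (dd z (\<lambda>y. \<Gamma> y v w) u) f u + dd z (dd (\<Gamma> u v w) f) u"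
    by (rule dd_df_field[OF u differentiable_\<Gamma>[OF u]])
  finally have "dd z (dd v (dd w f)) u \<bullet> dd q f u =
      ip u (dd z (\<lambda>y. \<Gamma> y v w) u) q + ip u (\<Gamma> u z (\<Gamma> u v w)) q
      - ip u (A u v) w * ip u (A u z) q - ip u v w * ip u z q"
    by (simp add: inner_add_left inner_diff_left ip_\<Gamma>[OF u] n_ddf_shape_op[OF u] dn_eq[OF u] frame[OF u])
  then show ?thesis by (simp add: dd_add_dir[OF diff_f[OF u]] inner_add_left)
qed

text \<open>In the difference of the two second covariant derivatives the third derivatives of
  \<open>f\<close> cancel by symmetry, and only the quadratic terms remain.\<close>

lemma gauss_equation:
  assumes u: "u \<in> U"
  shows "curvature (levi_civita g) (\<lambda>_. z) (\<lambda>_. v) (\<lambda>_. w) u =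
    ip u (A u v) w *\<^sub>R A u z - ip u (A u z) w *\<^sub>R A u v + ip u v w *\<^sub>R z - ip u z w *\<^sub>R v"
    (is "?R = ?S")
proof -
  have "lie_bracket (\<lambda>_. z) (\<lambda>_. v) = (\<lambda>_. 0)" by (rule ext) (simp add: lie_bracket_def)
  then have R: "?R = (dd z (\<lambda>y. \<Gamma> y v w) u + \<Gamma> u z (\<Gamma> u v w))
      - (dd v (\<lambda>y. \<Gamma> y z w) u + \<Gamma> u v (\<Gamma> u z w))"
    by (simp add: curvature_def levi_civita_const levi_civita_eq \<Gamma>_0)
  have c: "dd z (dd v (dd w f)) u = dd v (dd z (dd w f)) u"
    by (rule dd_commute[OF open_U u smooth_df])
  have "ip u ?R q = ip u ?S q" for q
  proof -
    have "ip u ?R q = ip u (dd z (\<lambda>y. \<Gamma> y v w) u + \<Gamma> u z (\<Gamma> u v w)) q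
        - ip u (dd v (\<lambda>y. \<Gamma> y z w) u + \<Gamma> u v (\<Gamma> u z w)) q"
      unfolding R by (simp only: linear_diff[OF linear_df[OF u]] inner_diff_left)
    also have "\<dots> = ip u ?S q"
      unfolding ip_second_derivative[OF u] c
      by (simp add: linear_diff[OF linear_df[OF u]] linear_add[OF linear_df[OF u]]
          linear_scale[OF linear_df[OF u]] inner_add_left inner_diff_left)
    finally show ?thesis .
  qed
  then show ?thesis by (rule ip_eqI[OF u])
qed

lemma linear_ip_left: "u \<in> U \<Longrightarrow> linear (\<lambda>v. ip u v w)"
  by (rule linearI) (simp_all add: dd_add_dir dd_scaleR_dir diff_f inner_add_left)

abbreviation tr\<^sub>1 :: "real^'m \<Rightarrow> real" where "tr\<^sub>1 u \<equiv> trace (matrix (A u))"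
abbreviation tr\<^sub>2 :: "real^'m \<Rightarrow> real" where "tr\<^sub>2 u \<equiv> trace (matrix (\<lambda>v. A u (A u v)))"
abbreviation tr\<^sub>3 :: "real^'m \<Rightarrow> real" where "tr\<^sub>3 u \<equiv> trace (matrix (\<lambda>v. A u (A u (A u v))))"

text \<open>Terms of the Gauss equation with \<open>z\<close> inside an inner product are rank one
  in \<open>z\<close>, so their trace is that linear form at the fixed vector. They produce the
  square of \<open>A\<close> and the \<open>- 1\<close> next to the dimension.\<close>

lemma ricci_eq:
  assumes u: "u \<in> U"
  shows "ricci g u v w = ip u (tr\<^sub>1 u *\<^sub>R A u v - A u (A u v) + (real CARD('m) - 1) *\<^sub>R v) w"
proof -
  have lA: "linear (\<lambda>z. ip u (A u z) w)"
    using linear_compose[OF linear_shape_op[OF u] linear_ip_left[OF u, of w]] by (simp add: comp_def)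
  have "ricci g u v w = ip u (A u v) w * tr\<^sub>1 u - ip u (A u (A u v)) w + ip u v w * real CARD('m) - ip u v w"
    unfolding ricci_def gauss_equation[OF u]
    by (simp add: trace_matrix_diff trace_matrix_add trace_matrix_scaleR trace_matrix_ident
        trace_matrix_rank_one[OF lA] trace_matrix_rank_one[OF linear_ip_left[OF u]])
  then show ?thesis
    by (simp add: linear_diff[OF linear_df[OF u]] linear_add[OF linear_df[OF u]]
          linear_scale[OF linear_df[OF u]] inner_add_left inner_diff_left algebra_simps)
qed

lemma ricci_op_eq:
  assumes u: "u \<in> U"
  shows "ricci_op g u v = tr\<^sub>1 u *\<^sub>R A u v - A u (A u v) + (real CARD('m) - 1) *\<^sub>R v"
  unfolding ricci_op_def
  by (rule sharp_eqI[of g u, OF invertible_g[OF u]])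
    (simp add: vec_eq_iff g_mult[OF u] ricci_eq[OF u] pderiv_dir_eq_dd)

lemma scal_eq:
  assumes u: "u \<in> U"
  shows "scal g u = (tr\<^sub>1 u)\<^sup>2 - tr\<^sub>2 u + (real CARD('m) - 1) * real CARD('m)"
proof -
  have "scal g u = trace (matrix (\<lambda>v. tr\<^sub>1 u *\<^sub>R A u v - A u (A u v) + (real CARD('m) - 1) *\<^sub>R v))"
    unfolding scal_def by (simp only: ricci_op_eq[OF u, abs_def])
  then show ?thesis
    by (simp add: trace_matrix_diff trace_matrix_add trace_matrix_scaleR trace_matrix_ident power2_eq_square)
qed

section \<open>Tension field and Codazzi equation\<close>

lemma pullback_conn_eq: "pullback_conn f X V u = sphere_proj (f u) (dd (X u) V u)"
  by (simp add: pullback_conn_def dd_def)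

lemma second_form_eq:
  assumes u: "u \<in> U"
  shows "second_form g f u v w = ip u (A u v) w *\<^sub>R n u"
proof -
  have "second_form g f u v w = sphere_proj (f u) (dd v (dd w f) u) - dd (\<Gamma> u v w) f u"
    by (simp add: second_form_def levi_civita_const pullback_conn_eq flip: dd_def)
  then show ?thesis
    by (simp add: gauss_formula[OF u] sphere_proj_def inner_add_left inner_diff_left frame[OF u])
qed

lemma tension_eq: "u \<in> U \<Longrightarrow> tension g f u = tr\<^sub>1 u *\<^sub>R n u"
  unfolding tension_def by (rule metric_trace_ip) (simp_all add: second_form_eq)

text \<open>\<open>DA u v w\<close> is \<open>(\<nabla>\<^sub>v A) w\<close>.\<close>

definition DA :: "real^'m \<Rightarrow> real^'m \<Rightarrow> real^'m \<Rightarrow> real^'m" where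
  "DA u v w = dd v (\<lambda>y. A y w) u + \<Gamma> u v (A u w) - A u (\<Gamma> u v w)"

text \<open>Differentiating the relation between the derivative of \<open>n\<close> and
  \<open>A\<close> brings in second derivatives of \<open>n\<close>; their symmetry and that of
  \<open>\<Gamma>\<close> are then the Codazzi equation.\<close>

lemma ip_DA:
  assumes u: "u \<in> U"
  shows "ip u (DA u v w) q = dd (\<Gamma> u v w) n u \<bullet> dd q f u - dd v (dd w n) u \<bullet> dd q f u"
proof -
  have d: "(\<lambda>y. dd (A y w) f y) differentiable (at u)"
    by (rule differentiable_cong_open[OF open_U u df_shape_op, THEN iffD2], assumption)
      (use diff_dn[OF u] in simp)
  have "dd v (dd w n) u = dd v (\<lambda>y. - dd (A y w) f y) u"
    by (rule dd_cong_open[OF open_U u dn_eq])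
  also have "\<dots> = - (dd (dd v (\<lambda>y. A y w) u) f u + dd v (dd (A u w) f) u)"
    by (simp only: dd_minus[OF d] dd_df_field[OF u differentiable_shape_op[OF u]])
  finally show ?thesis
    by (simp add: DA_def linear_diff[OF linear_df[OF u]] linear_add[OF linear_df[OF u]]
       inner_add_left inner_diff_left ip_\<Gamma>[OF u] df_shape_op[OF u])
qed

lemma codazzi:
  assumes u: "u \<in> U" shows "DA u v w = DA u w v"
  by (rule ip_eqI[OF u])
    (simp only: ip_DA[OF u] \<Gamma>_commute[OF u, of v w] dd_commute[OF open_U u smooth_n, of v w])

text \<open>The form \<open>dd w n y \<bullet> dd q f y\<close> is symmetric in \<open>w\<close> and
  \<open>q\<close> on all of \<open>U\<close>, hence so is its derivative, and the two correction
  terms in \<open>\<Gamma>\<close> are exchanged by the swap.\<close>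

lemma DA_self_adjoint:
  assumes u: "u \<in> U" shows "ip u (DA u v w) q = ip u (DA u v q) w"
proof -
  have *: "dd v (dd w n) u \<bullet> dd q f u =
      dd v (\<lambda>y. dd w n y \<bullet> dd q f y) u - dd (\<Gamma> u v q) n u \<bullet> dd w f u" for w q
  proof -
    have "dd w n u \<bullet> dd v (dd q f) u = dd w n u \<bullet> dd (\<Gamma> u v q) f u"
      by (simp add: gauss_formula[OF u] inner_add_right inner_diff_right frame[OF u])
    also have "\<dots> = dd (\<Gamma> u v q) n u \<bullet> dd w f u" by (rule dn_df_commute[OF u])
    finally show ?thesis using dd_inner[OF diff_dn[OF u] diff_df[OF u], of v w q] by simp
  qed
  have "dd v (\<lambda>y. dd w n y \<bullet> dd q f y) u = dd v (\<lambda>y. dd q n y \<bullet> dd w f y) u"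
    by (rule dd_cong_open[OF open_U u dn_df_commute])
  then show ?thesis unfolding ip_DA[OF u] * by simp
qed

text \<open>The trace commutes with covariant differentiation: the derivatives of the diagonal
  entries add up to that of the constant \<open>t\<close>, and the \<open>\<Gamma>\<close> terms
  form a commutator.\<close>

lemma trace_DA:
  assumes u: "u \<in> U" and c: "\<And>y. y \<in> U \<Longrightarrow> tr\<^sub>1 y = t"
  shows "trace (matrix (DA u q)) = 0"
proof -
  have Ai: "(\<lambda>y. A y w $ i) differentiable (at u)" for w i
    by (rule differentiable_vec_nth[OF differentiable_shape_op[OF u]])
  have "(\<Sum>i\<in>UNIV. dd q (\<lambda>y. A y (axis i 1)) u $ i) = (\<Sum>i\<in>UNIV. dd q (\<lambda>y. A y (axis i 1) $ i) u)"
    by (simp add: dd_apply_bounded_linear[OF bounded_linear_vec_nth differentiable_shape_op[OF u]])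
  also have "\<dots> = dd q (\<lambda>y. \<Sum>i\<in>UNIV. A y (axis i 1) $ i) u"
    by (rule dd_sum[symmetric]) (rule Ai)
  also have "\<dots> = dd q (\<lambda>_. t) u"
    by (rule dd_cong_open[OF open_U u]) (simp add: c[symmetric] trace_matrix)
  finally have 1: "trace (matrix (\<lambda>w. dd q (\<lambda>y. A y w) u)) = 0"
    by (simp add: trace_matrix dd_const)
  have "trace (matrix (\<lambda>w. \<Gamma> u q (A u w))) = trace (matrix (\<lambda>w. A u (\<Gamma> u q w)))"
    by (rule trace_matrix_comp_commute[OF linear_\<Gamma> linear_shape_op[OF u]])
  then show ?thesis
    using 1 by (simp add: DA_def[abs_def] trace_matrix_diff trace_matrix_add)
qed

end

text \<open>These are the power sums that get differentiated: the first through the tension field,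
  both through the scalar curvature. The third enters only through its value at a point.\<close>

locale constant_trace_patch = hypersurface_patch U f n
  for U :: "(real^'m::finite) set" and f n :: "real^'m \<Rightarrow> 'e::euclidean_space" +
  fixes t\<^sub>1 t\<^sub>2 :: real
  assumes tr1: "u \<in> U \<Longrightarrow> tr\<^sub>1 u = t\<^sub>1" and tr2: "u \<in> U \<Longrightarrow> tr\<^sub>2 u = t\<^sub>2"
begin

lemma rough_laplacian_tension:
  assumes u: "u \<in> U"
  shows "rough_laplacian g f (tension g f) u = (t\<^sub>1 * t\<^sub>2) *\<^sub>R n u"
proof -
  have ten: "tension g f y = t\<^sub>1 *\<^sub>R n y" if "y \<in> U" for y
    using tension_eq[OF that] tr1[OF that] by simp
  have dten: "dd v (tension g f) y = t\<^sub>1 *\<^sub>R dd v n y" if "y \<in> U" for v y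
    using dd_cong_open[OF open_U that ten] dd_scaleR_const[OF diff_n[OF that]] by simp
  have P: "pullback_conn f X (tension g f) y = t\<^sub>1 *\<^sub>R dd (X y) n y" if "y \<in> U" for X y
    by (simp add: pullback_conn_eq dten[OF that] sphere_proj_def dn_f[OF that])
  \<comment> \<open>The second covariant derivative of \<open>n\<close> as a section of the
    pull-back bundle. Its trace is determined below from its components along \<open>f\<close>,
    \<open>n\<close> and the tangent vectors.\<close>
  define b where "b = (\<lambda>v w. sphere_proj (f u) (dd v (dd w n) u) - dd (\<Gamma> u v w) n u)"
  have PP: "pullback_conn f (\<lambda>_. v) (pullback_conn f (\<lambda>_. w) (tension g f)) u
      - pullback_conn f (levi_civita g (\<lambda>_. v) (\<lambda>_. w)) (tension g f) u = t\<^sub>1 *\<^sub>R b v w" for v w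
  proof -
    have "dd v (pullback_conn f (\<lambda>_. w) (tension g f)) u = dd v (\<lambda>y. t\<^sub>1 *\<^sub>R dd w n y) u"
      by (rule dd_cong_open[OF open_U u P])
    then have "pullback_conn f (\<lambda>_. v) (pullback_conn f (\<lambda>_. w) (tension g f)) u
        = t\<^sub>1 *\<^sub>R sphere_proj (f u) (dd v (dd w n) u)"
      by (simp add: pullback_conn_eq[of _ "pullback_conn f _ _"] dd_scaleR_const[OF diff_dn[OF u]]
          sphere_proj_def scaleR_diff_right)
    then show ?thesis by (simp add: P[OF u] levi_civita_const b_def scaleR_diff_right)
  qed
  have "metric_trace g u b = - t\<^sub>2 *\<^sub>R n u"
  proof (rule frame_eqI[OF u])
    have "b v w \<bullet> f u = 0" for v w
      by (simp add: b_def sphere_proj_def inner_diff_left frame[OF u])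
    then show "metric_trace g u b \<bullet> f u = (- t\<^sub>2 *\<^sub>R n u) \<bullet> f u"
      by (simp add: inner_metric_trace metric_trace_0 n_f[OF u])
    have "b v w \<bullet> n u = ip u (A u (A u v)) w *\<^sub>R (- 1)" for v w
    proof -
      have "b v w \<bullet> n u = - ip u (A u v) (A u w)"
        by (simp add: b_def sphere_proj_def inner_diff_left frame[OF u]) (simp add: dn_eq[OF u])
      then show ?thesis by (simp add: shape_op_self_adjoint[OF u])
    qed
    then have "metric_trace g u (\<lambda>v w. b v w \<bullet> n u) = tr\<^sub>2 u *\<^sub>R (- 1)"
      by (rule metric_trace_ip[OF u])
    then show "metric_trace g u b \<bullet> n u = (- t\<^sub>2 *\<^sub>R n u) \<bullet> n u"
      by (simp add: inner_metric_trace tr2[OF u] n_n[OF u])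
    \<comment> \<open>The tangential component involves the derivative of \<open>A\<close> in
      direction \<open>v\<close>. Self-adjointness and then Codazzi move \<open>q\<close> into the
      place of that direction, so that the metric trace becomes the trace of the derivative of
      \<open>A\<close> along \<open>q\<close>, which vanishes.\<close>
    fix q
    have "b v w \<bullet> dd q f u = ip u (DA u q v) w *\<^sub>R (- 1)" for v w
    proof -
      have "b v w \<bullet> dd q f u = - ip u (DA u v w) q"
        by (simp add: b_def sphere_proj_def inner_diff_left ip_DA[OF u] frame[OF u])
      also have "\<dots> = - ip u (DA u v q) w" by (simp only: DA_self_adjoint[OF u, of v w q])
      finally show ?thesis by (simp add: codazzi[OF u, of v q])
    qed
    then have "metric_trace g u (\<lambda>v w. b v w \<bullet> dd q f u) = trace (matrix (DA u q)) *\<^sub>R (- 1)"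
      by (rule metric_trace_ip[OF u])
    then show "metric_trace g u b \<bullet> dd q f u = (- t\<^sub>2 *\<^sub>R n u) \<bullet> dd q f u"
      by (simp add: inner_metric_trace trace_DA[OF u tr1] n_df[OF u])
  qed
  then show ?thesis by (simp add: rough_laplacian_def PP metric_trace_scaleR)
qed

lemma bitension_eq:
  assumes u: "u \<in> U"
  shows "bitension g f u = (t\<^sub>1 * (real CARD('m) - t\<^sub>2)) *\<^sub>R n u"
proof -
  have ten: "tension g f u = t\<^sub>1 *\<^sub>R n u"
    using tension_eq[OF u] tr1[OF u] by simp
  \<comment> \<open>The tension field is normal, so only the second term of the constant curvature
    formula survives.\<close>
  have "sphere_curvature (f u) (frechet_derivative f (at u) v) (tension g f u)
      (frechet_derivative f (at u) w) = ip u v w *\<^sub>R (- t\<^sub>1 *\<^sub>R n u)" for v w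
    unfolding dd_def[symmetric] ten
    by (subst sphere_curvature_eq)
      (simp_all add: frame[OF u])
  then have "metric_trace g u (\<lambda>v w. sphere_curvature (f u) (frechet_derivative f (at u) v)
      (tension g f u) (frechet_derivative f (at u) w)) = trace (matrix (\<lambda>v::real^'m. v)) *\<^sub>R (- t\<^sub>1 *\<^sub>R n u)"
    by (rule metric_trace_ip[OF u])
  then show ?thesis
    by (simp add: bitension_def rough_laplacian_tension[OF u] trace_matrix_ident algebra_simps)
qed

lemma c_bitension_eq:
  assumes u: "u \<in> U"
  shows "c_bitension g f u = c_bitension_coeff (real CARD('m)) t\<^sub>1 t\<^sub>2 (tr\<^sub>3 u) *\<^sub>R n u"
proof -
  let ?m = "real CARD('m)"
  have sc: "scal g y = t\<^sub>1\<^sup>2 - t\<^sub>2 + (?m - 1) * ?m" if "y \<in> U" for y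
    using scal_eq[OF that] tr1[OF that] tr2[OF that] by simp
  have "dd (axis j 1) (scal g) u = 0" for j
    by (rule trans[OF dd_cong_open[OF open_U u sc] dd_const])
  then have gr: "grad g (scal g) u = 0"
    unfolding grad_def
    by (intro sharp_eqI[of g u, OF invertible_g[OF u]]) (simp add: vec_eq_iff flip: dd_def)
  have "second_form g f u (ricci_op g u v) w = ip u (A u (ricci_op g u v)) w *\<^sub>R n u" for v w
    by (rule second_form_eq[OF u])
  then have "metric_trace g u (\<lambda>v w. second_form g f u (ricci_op g u v) w)
      = trace (matrix (\<lambda>v. A u (ricci_op g u v))) *\<^sub>R n u"
    by (rule metric_trace_ip[OF u])
  also have "(\<lambda>v. A u (ricci_op g u v))
      = (\<lambda>v. t\<^sub>1 *\<^sub>R A u (A u v) - A u (A u (A u v)) + (?m - 1) *\<^sub>R A u v)"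
    by (simp add: ricci_op_eq[OF u] tr1[OF u] linear_diff[OF linear_shape_op[OF u]]
        linear_add[OF linear_shape_op[OF u]] linear_scale[OF linear_shape_op[OF u]])
  also have "trace (matrix \<dots>) = t\<^sub>1 * t\<^sub>2 - tr\<^sub>3 u + (?m - 1) * t\<^sub>1"
    by (simp add: trace_matrix_diff trace_matrix_add trace_matrix_scaleR tr1[OF u] tr2[OF u])
  finally have "c_bitension g f u = (t\<^sub>1 * (?m - t\<^sub>2)) *\<^sub>R n u
      - (2 / 3 * (t\<^sub>1\<^sup>2 - t\<^sub>2 + (?m - 1) * ?m)) *\<^sub>R (t\<^sub>1 *\<^sub>R n u)
      + 2 *\<^sub>R ((t\<^sub>1 * t\<^sub>2 - tr\<^sub>3 u + (?m - 1) * t\<^sub>1) *\<^sub>R n u)"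
    using linear_0[OF linear_df[OF u]]
    by (simp add: c_bitension_def bitension_eq[OF u] sc[OF u] tension_eq[OF u] tr1[OF u] gr flip: dd_def)
  also have "\<dots> = c_bitension_coeff ?m t\<^sub>1 t\<^sub>2 (tr\<^sub>3 u) *\<^sub>R n u"
    by (simp add: c_bitension_coeff_def flip: scaleR_left_distrib scaleR_left_diff_distrib)
  finally show ?thesis .
qed

end

section \<open>Isoparametric families of degree 4\<close>

lemma hypersurface_patch_chart:
  fixes \<A> :: "('a::{t2_space, second_countable_topology}, 'm::finite) chart set"
    and \<phi> N :: "'a \<Rightarrow> 'e::euclidean_space"
  assumes "smooth_atlas \<A>" "oriented_hypersurface \<A> \<phi> N" and x: "(U, x) \<in> \<A>"
  shows "hypersurface_patch U (\<phi> \<circ> x) (N \<circ> x)"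
proof
  show "open U" using assms unfolding smooth_atlas_def by fast
  show "DIM('e) = CARD('m) + 2" using assms unfolding oriented_hypersurface_def by blast
  show "smooth_on U (\<phi> \<circ> x)" "smooth_on U (N \<circ> x)"
    using assms unfolding oriented_hypersurface_def smooth_map_def by fast+
  have *: "norm (\<phi> p) = 1 \<and> norm (N p) = 1 \<and> N p \<bullet> \<phi> p = 0" for p
    using assms unfolding oriented_hypersurface_def by blast
  fix u assume u: "u \<in> U"
  show "(\<phi> \<circ> x) u \<bullet> (\<phi> \<circ> x) u = 1" "(N \<circ> x) u \<bullet> (N \<circ> x) u = 1" "(N \<circ> x) u \<bullet> (\<phi> \<circ> x) u = 0"
    using *[of "x u"] by (simp_all add: norm_eq_1)
  have **: "\<forall>(U, x)\<in>\<A>. \<forall>u\<in>U. inj (frechet_derivative (\<phi> \<circ> x) (at u)) \<and>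
        (\<forall>v. N (x u) \<bullet> frechet_derivative (\<phi> \<circ> x) (at u) v = 0)"
    using assms unfolding oriented_hypersurface_def by blast
  have "inj (frechet_derivative (\<phi> \<circ> x) (at u))"
      "\<And>v. N (x u) \<bullet> frechet_derivative (\<phi> \<circ> x) (at u) v = 0"
    using bspec[OF ** x] u by auto
  then show "inj (\<lambda>v. dd v (\<phi> \<circ> x) u)" "\<And>v. (N \<circ> x) u \<bullet> dd v (\<phi> \<circ> x) u = 0"
    by (simp_all add: dd_def)
qed

lemma (in hypersurface_patch) trace_eq_sum_principal_curvatures:
  assumes u: "u \<in> U" and I: "finite I" "inj_on \<kappa> I"
    and mult: "\<And>i. i \<in> I \<Longrightarrow> curvature_mult f n u (\<kappa> i) = \<mu> i" and sum: "(\<Sum>i\<in>I. \<mu> i) = CARD('m)"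
    and L: "linear L" and LA: "\<And>k v. A u v = k *\<^sub>R v \<Longrightarrow> L v = h k *\<^sub>R v"
  shows "trace (matrix L) = (\<Sum>i\<in>I. real (\<mu> i) * h (\<kappa> i))"
proof -
  have dim: "dim {v. A u v = \<kappa> i *\<^sub>R v} = \<mu> i" if "i \<in> I" for i
    using mult[OF that] by (simp add: curvature_mult_def)
  have "trace (matrix L) = (\<Sum>k\<in>\<kappa> ` I. real (dim {v. A u v = k *\<^sub>R v}) * h k)"
  proof (rule trace_eq_sum_eigenvalues[OF linear_shape_op[OF u] _ _ L])
    show "(\<Sum>k\<in>\<kappa> ` I. dim {v. A u v = k *\<^sub>R v}) = CARD('m)"
      using sum dim by (simp add: sum.reindex[OF I(2)])
  qed (use I LA in auto)
  also have "\<dots> = (\<Sum>i\<in>I. real (\<mu> i) * h (\<kappa> i))"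
    using dim by (simp add: sum.reindex[OF I(2)])
  finally show ?thesis .
qed

lemma isoparametric_family_4_chart:
  fixes \<A> :: "('a::{t2_space, second_countable_topology}, 'm::finite) chart set"
    and \<phi> N :: "real \<Rightarrow> 'a \<Rightarrow> 'e::euclidean_space"
  assumes atlas: "smooth_atlas \<A>"
    and fam: "isoparametric_family 4 (\<lambda>i. if odd i then m\<^sub>1 else m\<^sub>2) \<A> \<phi> N"
    and card: "CARD('m) = 2 * (m\<^sub>1 + m\<^sub>2)"
    and s: "s \<in> {0<..<pi / 4}" and x: "(U, x) \<in> \<A>" and u: "u \<in> U"
  defines "a \<equiv> cot s - tan s"
  shows "c_bitension (induced_metric (\<phi> s) x) (\<phi> s \<circ> x) u =
      c_bitension_coeff (2 * (real m\<^sub>1 + real m\<^sub>2)) (real m\<^sub>1 * a - real m\<^sub>2 * (4 / a))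
       (real m\<^sub>1 * (a\<^sup>2 + 2) + real m\<^sub>2 * ((4 / a)\<^sup>2 + 2))
       (real m\<^sub>1 * (a ^ 3 + 3 * a) - real m\<^sub>2 * ((4 / a) ^ 3 + 3 * (4 / a))) *\<^sub>R N s (x u)"
    and "trace (matrix (shape_op (\<phi> s \<circ> x) (N s \<circ> x) u)) = real m\<^sub>1 * a - real m\<^sub>2 * (4 / a)"
    and "0 < m\<^sub>1"
proof -
  define \<mu> where "\<mu> = (\<lambda>i::nat. if odd i then m\<^sub>1 else m\<^sub>2)"
  define \<kappa> where "\<kappa> = (\<lambda>i::nat. cot (s + real (i - 1) * pi / real 4))"
  have s4: "s \<in> {0<..<pi / real 4}" using s by simp
  have iso: "isoparametric 4 \<A> (\<phi> s) (N s)"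
    using fam s4 unfolding isoparametric_family_def by blast
  then interpret H: hypersurface_patch U "\<phi> s \<circ> x" "N s \<circ> x"
    by (intro hypersurface_patch_chart[OF atlas _ x]) (simp add: isoparametric_def)
  have *: "\<forall>(U, x)\<in>\<A>. \<forall>u\<in>U. principal_curvatures (\<phi> s \<circ> x) (N s \<circ> x) u = \<kappa> ` {1..4} \<and>
        (\<forall>i\<in>{1..4}. curvature_mult (\<phi> s \<circ> x) (N s \<circ> x) u (\<kappa> i) = \<mu> i)"
    using fam s4 unfolding isoparametric_family_def \<mu>_def \<kappa>_def by blast
  have pc: "principal_curvatures (\<phi> s \<circ> x) (N s \<circ> x) y = \<kappa> ` {1..4}"
    and mult: "\<And>i. i \<in> {1..4} \<Longrightarrow> curvature_mult (\<phi> s \<circ> x) (N s \<circ> x) y (\<kappa> i) = \<mu> i" if "y \<in> U" for y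
    using bspec[OF * x] that by auto
  obtain K where K: "card K = 4" "\<forall>(U, x)\<in>\<A>. \<forall>u\<in>U. principal_curvatures (\<phi> s \<circ> x) (N s \<circ> x) u = K"
    using iso unfolding isoparametric_def by fast
  have "K = \<kappa> ` {1..4}" using bspec[OF K(2) x] u pc[OF u] by auto
  \<comment> \<open>That the four cotangents differ is read off from the degree: the set of
    principal curvatures has four elements.\<close>
  then have inj: "inj_on \<kappa> {1..4}" using K(1) by (intro eq_card_imp_inj_on) auto
  have "{1..4} = {1, 2, 3, 4::nat}" by auto
  then have sum: "(\<Sum>i\<in>{1..4}. \<mu> i) = CARD('m)" by (simp add: \<mu>_def card)
  have w: "real (\<mu> i) = (if odd i then real m\<^sub>1 else real m\<^sub>2)" for i by (simp add: \<mu>_def)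
  note pow = cot_power_sums[where w = "\<lambda>i. real (\<mu> i)", OF s w]
  have tr: "trace (matrix L) = (\<Sum>i\<in>{1..4}. real (\<mu> i) * h (\<kappa> i))"
    if "y \<in> U" "linear L" "\<And>k v. H.A y v = k *\<^sub>R v \<Longrightarrow> L v = h k *\<^sub>R v" for y L h
    by (rule H.trace_eq_sum_principal_curvatures[OF that(1) _ inj mult[OF that(1)] sum that(2,3)])
      simp_all
  have lin: "linear (H.A y)" if "y \<in> U" for y by (rule H.linear_shape_op[OF that])
  have lin2: "linear (\<lambda>v. H.A y (H.A y v))" if "y \<in> U" for y
    using linear_compose[OF lin[OF that] lin[OF that]] by (simp add: comp_def)
  have lin3: "linear (\<lambda>v. H.A y (H.A y (H.A y v)))" if "y \<in> U" for y
    using linear_compose[OF lin2[OF that] lin[OF that]] by (simp add: comp_def)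
  have tr1: "H.tr\<^sub>1 y = real m\<^sub>1 * a - real m\<^sub>2 * (4 / a)" if y: "y \<in> U" for y
  proof -
    have "H.tr\<^sub>1 y = (\<Sum>i\<in>{1..4}. real (\<mu> i) * \<kappa> i)"
      by (rule tr[OF y lin[OF y], where h = "\<lambda>k. k"]) auto
    then show ?thesis unfolding \<kappa>_def a_def pow(2) .
  qed
  have tr2: "H.tr\<^sub>2 y = real m\<^sub>1 * (a\<^sup>2 + 2) + real m\<^sub>2 * ((4 / a)\<^sup>2 + 2)" if y: "y \<in> U" for y
  proof -
    have "H.tr\<^sub>2 y = (\<Sum>i\<in>{1..4}. real (\<mu> i) * (\<kappa> i)\<^sup>2)"
      by (rule tr[OF y lin2[OF y], where h = "\<lambda>k. k\<^sup>2"])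
        (auto simp: linear_scale[OF lin[OF y]] power2_eq_square)
    then show ?thesis unfolding \<kappa>_def a_def pow(3) .
  qed
  have tr3: "H.tr\<^sub>3 y = real m\<^sub>1 * (a ^ 3 + 3 * a) - real m\<^sub>2 * ((4 / a) ^ 3 + 3 * (4 / a))" if y: "y \<in> U" for y
  proof -
    have "H.tr\<^sub>3 y = (\<Sum>i\<in>{1..4}. real (\<mu> i) * (\<kappa> i) ^ 3)"
      by (rule tr[OF y lin3[OF y], where h = "\<lambda>k. k ^ 3"])
        (auto simp: linear_scale[OF lin[OF y]] power3_eq_cube)
    then show ?thesis unfolding \<kappa>_def a_def pow(4) .
  qed
  interpret H: constant_trace_patch U "\<phi> s \<circ> x" "N s \<circ> x" "real m\<^sub>1 * a - real m\<^sub>2 * (4 / a)"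
      "real m\<^sub>1 * (a\<^sup>2 + 2) + real m\<^sub>2 * ((4 / a)\<^sup>2 + 2)"
    by unfold_locales (fact tr1 tr2)+
  have "induced_metric (\<phi> s) x = H.g"
    by (rule ext) (simp add: induced_metric_def H.g_def)
  then show "c_bitension (induced_metric (\<phi> s) x) (\<phi> s \<circ> x) u =
      c_bitension_coeff (2 * (real m\<^sub>1 + real m\<^sub>2)) (real m\<^sub>1 * a - real m\<^sub>2 * (4 / a))
       (real m\<^sub>1 * (a\<^sup>2 + 2) + real m\<^sub>2 * ((4 / a)\<^sup>2 + 2))
       (real m\<^sub>1 * (a ^ 3 + 3 * a) - real m\<^sub>2 * ((4 / a) ^ 3 + 3 * (4 / a))) *\<^sub>R N s (x u)"
    using H.c_bitension_eq[OF u] by (simp only: tr3[OF u] card) simp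
  show "trace (matrix (shape_op (\<phi> s \<circ> x) (N s \<circ> x) u)) = real m\<^sub>1 * a - real m\<^sub>2 * (4 / a)"
    by (rule tr1[OF u])
  have "\<kappa> 1 \<in> principal_curvatures (\<phi> s \<circ> x) (N s \<circ> x) u" unfolding pc[OF u] by simp
  then obtain v where v: "v \<noteq> 0" "H.A u v = \<kappa> 1 *\<^sub>R v" by (auto simp: principal_curvatures_def)
  \<comment> \<open>The first curvature occurs, so its eigenspace contains a nonzero vector and its
    dimension, the first multiplicity, is positive.\<close>
  have d: "dim {v. H.A u v = \<kappa> 1 *\<^sub>R v} = m\<^sub>1"
    using mult[OF u, of 1] by (simp add: curvature_mult_def \<mu>_def)
  have "m\<^sub>1 \<noteq> 0" unfolding d[symmetric] using v by (auto simp: dim_eq_0)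
  then show "0 < m\<^sub>1" by simp
qed

theorem theorem4p4:
  fixes \<A> :: "('a::{t2_space, second_countable_topology}, 'm::finite) chart set"
    and \<phi> N :: "real \<Rightarrow> 'a \<Rightarrow> 'e::euclidean_space"
    and m\<^sub>1 m\<^sub>2 :: nat
  assumes "smooth_atlas \<A>"
    and "isoparametric_family 4 (\<lambda>i. if odd i then m\<^sub>1 else m\<^sub>2) \<A> \<phi> N"
    and "m\<^sub>1 < m\<^sub>2"
    and "CARD('m) = 2 * (m\<^sub>1 + m\<^sub>2)"
  shows "(\<exists>!s. s \<in> {0<..<pi / 4} \<and> isoparametric 4 \<A> (\<phi> s) (N s)
              \<and> c_biharmonic_hypersurface \<A> (\<phi> s) (N s))
       \<and> (\<forall>s\<in>{0<..<pi / 4}. c_biharmonic_hypersurface \<A> (\<phi> s) (N s)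
              \<longrightarrow> \<not> minimal_hypersurface \<A> (\<phi> s) (N s))"
proof -
  define C where "C = (\<lambda>a. c_bitension_coeff (2 * (real m\<^sub>1 + real m\<^sub>2)) (real m\<^sub>1 * a - real m\<^sub>2 * (4 / a))
       (real m\<^sub>1 * (a\<^sup>2 + 2) + real m\<^sub>2 * ((4 / a)\<^sup>2 + 2))
       (real m\<^sub>1 * (a ^ 3 + 3 * a) - real m\<^sub>2 * ((4 / a) ^ 3 + 3 * (4 / a))))"
  note chart = isoparametric_family_4_chart[OF assms(1,2,4)]
  have bit: "c_bitension (induced_metric (\<phi> s) x) (\<phi> s \<circ> x) u = C (cot s - tan s) *\<^sub>R N s (x u)"
    if "s \<in> {0<..<pi / 4}" "(U, x) \<in> \<A>" "u \<in> U" for s U x u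
    unfolding C_def by (rule chart(1)[OF that])
  \<comment> \<open>The conditions quantify over chart points; a point that exists is required to
    extract the scalar equation from them.\<close>
  obtain p :: 'a where "p \<in> UNIV" by simp
  then obtain U x u where x: "(U, x) \<in> \<A>" "u \<in> U"
    using assms(1) unfolding smooth_atlas_def by blast
  have iso: "isoparametric 4 \<A> (\<phi> s) (N s)" and ori: "oriented_hypersurface \<A> (\<phi> s) (N s)"
    if "s \<in> {0<..<pi / 4}" for s
    using assms(2) that unfolding isoparametric_family_def isoparametric_def by auto
  \<comment> \<open>Any parameter in the interval would do in place of
    \<open>pi / 8\<close>.\<close>
  have m1: "0 < m\<^sub>1" using chart(3)[OF _ x, of "pi / 8"] by simp
  have bih: "c_biharmonic_hypersurface \<A> (\<phi> s) (N s) \<longleftrightarrow> C (cot s - tan s) = 0"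
    if s: "s \<in> {0<..<pi / 4}" for s
  proof
    assume "c_biharmonic_hypersurface \<A> (\<phi> s) (N s)"
    then have "\<forall>(U, x)\<in>\<A>. \<forall>u\<in>U. c_bitension (induced_metric (\<phi> s) x) (\<phi> s \<circ> x) u = 0"
      unfolding c_biharmonic_hypersurface_def c_biharmonic_def by blast
    then have "C (cot s - tan s) *\<^sub>R N s (x u) = 0" using x bit[OF s x] by auto
    moreover have "norm (N s (x u)) = 1" using ori[OF s] unfolding oriented_hypersurface_def by blast
    ultimately show "C (cot s - tan s) = 0" by auto
  next
    assume "C (cot s - tan s) = 0"
    then have "\<forall>(U, x)\<in>\<A>. \<forall>u\<in>U. c_bitension (induced_metric (\<phi> s) x) (\<phi> s \<circ> x) u = 0"
      using bit[OF s] by auto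
    then show "c_biharmonic_hypersurface \<A> (\<phi> s) (N s)"
      using ori[OF s] unfolding c_biharmonic_hypersurface_def c_biharmonic_def oriented_hypersurface_def
      by auto
  qed
  have "\<exists>!a. a > 0 \<and> C a = 0"
    unfolding C_def by (rule ex1_c_bitension_coeff_eq_0[OF m1 assms(3)])
  then obtain a where a: "a > 0 \<and> C a = 0" "\<forall>b. b > 0 \<and> C b = 0 \<longrightarrow> b = a" by (rule ex1E)
  have pos: "cot s - tan s > 0" if "s \<in> {0<..<pi / 4}" for s :: real
    by (rule cot_power_sums(1)[OF that refl])
  have "s \<in> {0<..<pi / 4} \<and> isoparametric 4 \<A> (\<phi> s) (N s) \<and> c_biharmonic_hypersurface \<A> (\<phi> s) (N s)
      \<longleftrightarrow> s \<in> {0<..<pi / 4} \<and> cot s - tan s = a" for s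
    using bih iso pos a by blast
  moreover have "\<exists>!s. s \<in> {0<..<pi / 4} \<and> cot s - tan s = a"
    using cot_minus_tan_bij a(1) by blast
  ultimately have "\<exists>!s. s \<in> {0<..<pi / 4} \<and> isoparametric 4 \<A> (\<phi> s) (N s)
      \<and> c_biharmonic_hypersurface \<A> (\<phi> s) (N s)" by presburger
  moreover have "\<not> minimal_hypersurface \<A> (\<phi> s) (N s)"
    if s: "s \<in> {0<..<pi / 4}" and c: "c_biharmonic_hypersurface \<A> (\<phi> s) (N s)" for s
  proof
    assume "minimal_hypersurface \<A> (\<phi> s) (N s)"
    then have "trace (matrix (shape_op (\<phi> s \<circ> x) (N s \<circ> x) u)) = 0"
      using x unfolding minimal_hypersurface_def by fast
    then have "real m\<^sub>1 * (cot s - tan s) - real m\<^sub>2 * (4 / (cot s - tan s)) = 0"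
      using chart(2)[OF s x] by simp
    then have "C (cot s - tan s) \<noteq> 0"
      unfolding C_def using m1 assms(3) pos[OF s] by (intro c_bitension_coeff_not_minimal) simp_all
    then show False using bih[OF s] c by simp
  qed
  ultimately show ?thesis by blast
qed

end
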